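(* Let $A$ and $B$ be groups, $H\leqslant A$ and $K\leqslant B$ subgroups, $\varphi: H\to K$ an isomorphism, and let $G=(A*B;\,H=K,\varphi)$ be the free product of $A$ and $B$ with $H$ and $K$ amalgamated according to $\varphi$. Let $\Omega$ be the family of all pairs of $(H,K,\varphi)$-compatible normal subgroups of finite index of $A$ and $B$, and let $\Omega_A$, $\Omega_B$ be its projections to $A$ and $B$. Suppose that $\Omega_A$ is an $H$-filtration and $\Omega_B$ is a $K$-filtration. Then every cyclic subgroup of $G$ that is not conjugate in $G$ to any subgroup of the family $\Lambda_A\cup\Lambda_B$ is finitely separable in $G$.
   Context: A subgroup $F$ of a group $X$ is finitely separable in $X$ if for every $g\in X\setminus F$ there is a homomorphism $\psi$ of $X$ onto a finite group with $g\psi\notin F\psi$. For a family $\Psi$ of normal subgroups of $X$, a subgroup $F\leqslant X$ is separable by the subgroups of $\Psi$ if $\bigcap_{N\in\Psi}FN=F$. For a subgroup $Y\leqslant X$, the family $\Psi$ is a $Y$-filtration if $\bigcap_{N\in\Psi}N=1$ and $Y$ is separable by the subgroups of $\Psi$. Subgroups $R\leqslant A$ and $S\leqslant B$ are $(H,K,\varphi)$-compatible if $(R\cap H)\varphi=S\cap K$. $\Omega$ is the set of all pairs $(R,S)$ where $R$ is a normal subgroup of finite index of $A$, $S$ is a normal subgroup of finite index of $B$, and $R,S$ are $(H,K,\varphi)$-compatible; $\Omega_A$ (resp. $\Omega_B$) is the set of first (resp. second) components of elements of $\Omega$. $\Lambda_A$ (resp. $\Lambda_B$) is the family of all cyclic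 subgroups of $A$ (resp. $B$) that are not separable by the subgroups of $\Omega_A$ (resp. $\Omega_B$). *)

theory Defs
  imports "HOL-Algebra.Generated_Groups"
begin

definition cyclic_subgroup :: "'a set \<Rightarrow> ('a, 'm) monoid_scheme \<Rightarrow> bool" where
  "cyclic_subgroup C X \<longleftrightarrow> (\<exists>c\<in>carrier X. C = generate X {c})"

definition conjugate_in :: "('a, 'm) monoid_scheme \<Rightarrow> 'a set \<Rightarrow> 'a set \<Rightarrow> bool" where
  "conjugate_in X C D \<longleftrightarrow>
     (\<exists>g\<in>carrier X. C = (\<lambda>x. inv\<^bsub>X\<^esub> g \<otimes>\<^bsub>X\<^esub> x \<otimes>\<^bsub>X\<^esub> g) ` D)"

(* HOL cannot quantify over the type of the finite quotient group.  The type nat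
   loses nothing: every finite group is isomorphic to one whose carrier is a
   finite set of natural numbers. *)
definition finitely_separable :: "'a set \<Rightarrow> ('a, 'm) monoid_scheme \<Rightarrow> bool" where
  "finitely_separable F X \<longleftrightarrow> subgroup F X \<and>
     (\<forall>g\<in>carrier X - F. \<exists>(Q :: nat monoid) \<psi>.
        group Q \<and> finite (carrier Q) \<and> \<psi> \<in> epi X Q \<and> \<psi> g \<notin> \<psi> ` F)"

(* The intersection with the carrier only matters for the empty family, where the
   bare intersection would be the whole type. *)
definition separable_by :: "('a, 'm) monoid_scheme \<Rightarrow> 'a set \<Rightarrow> 'a set set \<Rightarrow> bool" where
  "separable_by X F \<Psi> \<longleftrightarrow> carrier X \<inter> (\<Inter>N\<in>\<Psi>. F <#>\<^bsub>X\<^esub> N) = F"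

definition filtration :: "('a, 'm) monoid_scheme \<Rightarrow> 'a set \<Rightarrow> 'a set set \<Rightarrow> bool" where
  "filtration X Y \<Psi> \<longleftrightarrow> (\<forall>N\<in>\<Psi>. N \<lhd> X) \<and>
     carrier X \<inter> (\<Inter>N\<in>\<Psi>. N) = {\<one>\<^bsub>X\<^esub>} \<and> separable_by X Y \<Psi>"

definition compatible ::
  "'a set \<Rightarrow> 'b set \<Rightarrow> ('a \<Rightarrow> 'b) \<Rightarrow> 'a set \<Rightarrow> 'b set \<Rightarrow> bool" where
  "compatible H K \<phi> R S \<longleftrightarrow> \<phi> ` (R \<inter> H) = S \<inter> K"

definition Omega :: "('a, 'm) monoid_scheme \<Rightarrow> ('b, 'n) monoid_scheme \<Rightarrow>
    'a set \<Rightarrow> 'b set \<Rightarrow> ('a \<Rightarrow> 'b) \<Rightarrow> ('a set \<times> 'b set) set" where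
  "Omega A B H K \<phi> = {(R, S).
     R \<lhd> A \<and> finite (rcosets\<^bsub>A\<^esub> R) \<and> S \<lhd> B \<and> finite (rcosets\<^bsub>B\<^esub> S) \<and>
     compatible H K \<phi> R S}"

definition Omega_A :: "('a, 'm) monoid_scheme \<Rightarrow> ('b, 'n) monoid_scheme \<Rightarrow>
    'a set \<Rightarrow> 'b set \<Rightarrow> ('a \<Rightarrow> 'b) \<Rightarrow> 'a set set" where
  "Omega_A A B H K \<phi> = fst ` Omega A B H K \<phi>"

definition Omega_B :: "('a, 'm) monoid_scheme \<Rightarrow> ('b, 'n) monoid_scheme \<Rightarrow>
    'a set \<Rightarrow> 'b set \<Rightarrow> ('a \<Rightarrow> 'b) \<Rightarrow> 'b set set" where
  "Omega_B A B H K \<phi> = snd ` Omega A B H K \<phi>"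

definition Lambda_A :: "('a, 'm) monoid_scheme \<Rightarrow> ('b, 'n) monoid_scheme \<Rightarrow>
    'a set \<Rightarrow> 'b set \<Rightarrow> ('a \<Rightarrow> 'b) \<Rightarrow> 'a set set" where
  "Lambda_A A B H K \<phi> =
     {C. cyclic_subgroup C A \<and> \<not> separable_by A C (Omega_A A B H K \<phi>)}"

definition Lambda_B :: "('a, 'm) monoid_scheme \<Rightarrow> ('b, 'n) monoid_scheme \<Rightarrow>
    'a set \<Rightarrow> 'b set \<Rightarrow> ('a \<Rightarrow> 'b) \<Rightarrow> 'b set set" where
  "Lambda_B A B H K \<phi> =
     {C. cyclic_subgroup C B \<and> \<not> separable_by B C (Omega_B A B H K \<phi>)}"

(* The free product with amalgamation is given by its presentation: words over the
   disjoint union of A and B, modulo the least congruence that contains the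
   multiplication tables of A and B and the relations h = \<phi> h for h in H.  Inverse
   letters are not needed, since A and B are groups.  The subgroup K of B is not an
   argument, being the image of H under \<phi>. *)
inductive_set amalg_cong :: "('a, 'm) monoid_scheme \<Rightarrow> ('b, 'n) monoid_scheme \<Rightarrow>
    'a set \<Rightarrow> ('a \<Rightarrow> 'b) \<Rightarrow> (('a + 'b) list \<times> ('a + 'b) list) set"
  for A B H \<phi> where
  refl: "u \<in> lists (carrier A <+> carrier B) \<Longrightarrow> (u, u) \<in> amalg_cong A B H \<phi>"
| sym: "(u, v) \<in> amalg_cong A B H \<phi> \<Longrightarrow> (v, u) \<in> amalg_cong A B H \<phi>"
| trans: "(u, v) \<in> amalg_cong A B H \<phi> \<Longrightarrow> (v, w) \<in> amalg_cong A B H \<phi> \<Longrightarrow>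
    (u, w) \<in> amalg_cong A B H \<phi>"
| append: "(u, u') \<in> amalg_cong A B H \<phi> \<Longrightarrow> (v, v') \<in> amalg_cong A B H \<phi> \<Longrightarrow>
    (u @ v, u' @ v') \<in> amalg_cong A B H \<phi>"
| one_A: "([Inl \<one>\<^bsub>A\<^esub>], []) \<in> amalg_cong A B H \<phi>"
| one_B: "([Inr \<one>\<^bsub>B\<^esub>], []) \<in> amalg_cong A B H \<phi>"
| mult_A: "x \<in> carrier A \<Longrightarrow> y \<in> carrier A \<Longrightarrow>
    ([Inl x, Inl y], [Inl (x \<otimes>\<^bsub>A\<^esub> y)]) \<in> amalg_cong A B H \<phi>"
| mult_B: "x \<in> carrier B \<Longrightarrow> y \<in> carrier B \<Longrightarrow>
    ([Inr x, Inr y], [Inr (x \<otimes>\<^bsub>B\<^esub> y)]) \<in> amalg_cong A B H \<phi>"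
| amalg: "h \<in> H \<Longrightarrow> ([Inl h], [Inr (\<phi> h)]) \<in> amalg_cong A B H \<phi>"

definition amalg_product :: "('a, 'm) monoid_scheme \<Rightarrow> ('b, 'n) monoid_scheme \<Rightarrow>
    'a set \<Rightarrow> ('a \<Rightarrow> 'b) \<Rightarrow> ('a + 'b) list set monoid" where
  "amalg_product A B H \<phi> =
     \<lparr>carrier = lists (carrier A <+> carrier B) // amalg_cong A B H \<phi>,
      mult = (\<lambda>U V. \<Union>u\<in>U. \<Union>v\<in>V. amalg_cong A B H \<phi> `` {u @ v}),
      one = amalg_cong A B H \<phi> `` {[]}\<rparr>"

definition amalg_inl :: "('a, 'm) monoid_scheme \<Rightarrow> ('b, 'n) monoid_scheme \<Rightarrow>
    'a set \<Rightarrow> ('a \<Rightarrow> 'b) \<Rightarrow> 'a \<Rightarrow> ('a + 'b) list set" where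
  "amalg_inl A B H \<phi> a = amalg_cong A B H \<phi> `` {[Inl a]}"

definition amalg_inr :: "('a, 'm) monoid_scheme \<Rightarrow> ('b, 'n) monoid_scheme \<Rightarrow>
    'a set \<Rightarrow> ('a \<Rightarrow> 'b) \<Rightarrow> 'b \<Rightarrow> ('a + 'b) list set" where
  "amalg_inr A B H \<phi> b = amalg_cong A B H \<phi> `` {[Inr b]}"

text \<open>The presentation defines a group with the universal property of the pushout.\<close>

context
  fixes A :: "('a, 'm) monoid_scheme" and B :: "('b, 'n) monoid_scheme"
    and H :: "'a set" and K :: "'b set" and \<phi> :: "'a \<Rightarrow> 'b"
  assumes A: "group A" and B: "group B" and H: "subgroup H A" and K: "subgroup K B"
    and phi: "\<phi> \<in> iso (A\<lparr>carrier := H\<rparr>) (B\<lparr>carrier := K\<rparr>)"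
begin

lemma amalg_cong_words:
  assumes "(u, v) \<in> amalg_cong A B H \<phi>"
  shows "u \<in> lists (carrier A <+> carrier B) \<and> v \<in> lists (carrier A <+> carrier B)"
proof -
  interpret A: group A by (rule A)
  interpret B: group B by (rule B)
  have HK: "h \<in> carrier A" "\<phi> h \<in> carrier B" if "h \<in> H" for h
    using that subgroup.subset[OF H] subgroup.subset[OF K] phi
    by (auto simp: iso_def hom_def)
  show ?thesis
    using assms by (induction rule: amalg_cong.induct) (auto simp: HK)
qed

lemma equiv_amalg_cong: "equiv (lists (carrier A <+> carrier B)) (amalg_cong A B H \<phi>)"
  using amalg_cong_words
  by (intro equivI refl_onI symI transI)
    (auto intro: amalg_cong.refl amalg_cong.sym amalg_cong.trans)

lemma amalg_class_eq:
  "(u, v) \<in> amalg_cong A B H \<phi> \<Longrightarrow>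
    amalg_cong A B H \<phi> `` {u} = amalg_cong A B H \<phi> `` {v}"
  by (rule equiv_class_eq[OF equiv_amalg_cong])

lemma amalg_mult_class:
  assumes "u \<in> lists (carrier A <+> carrier B)" "v \<in> lists (carrier A <+> carrier B)"
  shows "amalg_cong A B H \<phi> `` {u} \<otimes>\<^bsub>amalg_product A B H \<phi>\<^esub> amalg_cong A B H \<phi> `` {v}
    = amalg_cong A B H \<phi> `` {u @ v}"
  using amalg_cong.refl[OF assms(1), of H \<phi>] amalg_cong.refl[OF assms(2), of H \<phi>]
  unfolding amalg_product_def
  by (auto intro: amalg_cong.append amalg_cong.trans)

lemma amalg_carrierE:
  assumes "U \<in> carrier (amalg_product A B H \<phi>)"
  obtains u where "u \<in> lists (carrier A <+> carrier B)" "U = amalg_cong A B H \<phi> `` {u}"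
  using assms unfolding amalg_product_def by (force elim: quotientE)

lemma amalg_class_carrier:
  "u \<in> lists (carrier A <+> carrier B) \<Longrightarrow>
    amalg_cong A B H \<phi> `` {u} \<in> carrier (amalg_product A B H \<phi>)"
  unfolding amalg_product_def by (simp add: quotientI)

lemma amalg_word_inverse:
  assumes "u \<in> lists (carrier A <+> carrier B)"
  shows "\<exists>v\<in>lists (carrier A <+> carrier B). (v @ u, []) \<in> amalg_cong A B H \<phi>"
  using assms
proof (induction u)
  case Nil
  then show ?case by (auto intro: amalg_cong.refl)
next
  case (Cons x u)
  interpret A: group A by (rule A)
  interpret B: group B by (rule B)
  obtain v where v: "v \<in> lists (carrier A <+> carrier B)" "(v @ u, []) \<in> amalg_cong A B H \<phi>"
    using Cons.IH by blast
  have "\<exists>y\<in>carrier A <+> carrier B. ([y, x], []) \<in> amalg_cong A B H \<phi>"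
  proof (cases x)
    case (Inl a)
    then have a: "a \<in> carrier A" using Cons.hyps by auto
    have "([Inl (inv\<^bsub>A\<^esub> a), Inl a], [Inl \<one>\<^bsub>A\<^esub>]) \<in> amalg_cong A B H \<phi>"
      using amalg_cong.mult_A[of "inv\<^bsub>A\<^esub> a" A a B H \<phi>] a by simp
    then have "([Inl (inv\<^bsub>A\<^esub> a), x], []) \<in> amalg_cong A B H \<phi>"
      unfolding Inl by (blast intro: amalg_cong.trans amalg_cong.one_A)
    then show ?thesis using a by (blast intro: A.inv_closed)
  next
    case (Inr b)
    then have b: "b \<in> carrier B" using Cons.hyps by auto
    have "([Inr (inv\<^bsub>B\<^esub> b), Inr b], [Inr \<one>\<^bsub>B\<^esub>]) \<in> amalg_cong A B H \<phi>"
      using amalg_cong.mult_B[of "inv\<^bsub>B\<^esub> b" B b A H \<phi>] b by simp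
    then have "([Inr (inv\<^bsub>B\<^esub> b), x], []) \<in> amalg_cong A B H \<phi>"
      unfolding Inr by (blast intro: amalg_cong.trans amalg_cong.one_B)
    then show ?thesis using b by (blast intro: B.inv_closed)
  qed
  then obtain y where y: "y \<in> carrier A <+> carrier B" "([y, x], []) \<in> amalg_cong A B H \<phi>"
    by blast
  have "(v @ [y, x] @ u, v @ [] @ u) \<in> amalg_cong A B H \<phi>"
    using v(1) y Cons.hyps by (intro amalg_cong.append) (auto intro: amalg_cong.refl)
  then have "((v @ [y]) @ x # u, []) \<in> amalg_cong A B H \<phi>"
    using amalg_cong.trans[OF _ v(2)] by simp
  moreover have "v @ [y] \<in> lists (carrier A <+> carrier B)"
    using v(1) y(1) by auto
  ultimately show ?case by blast
qed

lemma group_amalg_product: "group (amalg_product A B H \<phi>)"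
proof (rule groupI)
  let ?W = "lists (carrier A <+> carrier B)"
  let ?G = "amalg_product A B H \<phi>"
  have one: "\<one>\<^bsub>?G\<^esub> = amalg_cong A B H \<phi> `` {[]}"
    by (simp add: amalg_product_def)
  have appW: "u @ v \<in> ?W" if "u \<in> ?W" "v \<in> ?W" for u v
    using that by auto
  have nilW: "[] \<in> ?W" by simp
  show "\<one>\<^bsub>?G\<^esub> \<in> carrier ?G"
    unfolding one by (rule amalg_class_carrier) simp
  fix U assume U: "U \<in> carrier ?G"
  obtain u where u: "u \<in> ?W" "U = amalg_cong A B H \<phi> `` {u}"
    using U by (rule amalg_carrierE)
  show "\<one>\<^bsub>?G\<^esub> \<otimes>\<^bsub>?G\<^esub> U = U"
    unfolding one u(2) amalg_mult_class[OF nilW u(1)] by simp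
  obtain v where v: "v \<in> ?W" "(v @ u, []) \<in> amalg_cong A B H \<phi>"
    using amalg_word_inverse[OF u(1)] by blast
  show "\<exists>V\<in>carrier ?G. V \<otimes>\<^bsub>?G\<^esub> U = \<one>\<^bsub>?G\<^esub>"
    using amalg_class_carrier[OF v(1)] amalg_mult_class[OF v(1) u(1)] amalg_class_eq[OF v(2)]
    unfolding one u(2) by metis
  fix V assume V: "V \<in> carrier ?G"
  obtain v where v: "v \<in> ?W" "V = amalg_cong A B H \<phi> `` {v}"
    using V by (rule amalg_carrierE)
  show "U \<otimes>\<^bsub>?G\<^esub> V \<in> carrier ?G"
    unfolding u(2) v(2) amalg_mult_class[OF u(1) v(1)]
    by (rule amalg_class_carrier[OF appW[OF u(1) v(1)]])
  fix X assume X: "X \<in> carrier ?G"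
  obtain x where x: "x \<in> ?W" "X = amalg_cong A B H \<phi> `` {x}"
    using X by (rule amalg_carrierE)
  show "U \<otimes>\<^bsub>?G\<^esub> V \<otimes>\<^bsub>?G\<^esub> X = U \<otimes>\<^bsub>?G\<^esub> (V \<otimes>\<^bsub>?G\<^esub> X)"
    unfolding u(2) v(2) x(2) amalg_mult_class[OF u(1) v(1)] amalg_mult_class[OF v(1) x(1)]
      amalg_mult_class[OF appW[OF u(1) v(1)] x(1)] amalg_mult_class[OF u(1) appW[OF v(1) x(1)]]
    by simp
qed

lemma amalg_inl_hom: "amalg_inl A B H \<phi> \<in> hom A (amalg_product A B H \<phi>)"
proof (rule homI)
  fix x y assume xy: "x \<in> carrier A" "y \<in> carrier A"
  show "amalg_inl A B H \<phi> x \<in> carrier (amalg_product A B H \<phi>)"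
    unfolding amalg_inl_def using xy by (intro amalg_class_carrier) auto
  show "amalg_inl A B H \<phi> (x \<otimes>\<^bsub>A\<^esub> y) =
      amalg_inl A B H \<phi> x \<otimes>\<^bsub>amalg_product A B H \<phi>\<^esub> amalg_inl A B H \<phi> y"
    using amalg_class_eq[OF amalg_cong.mult_A[OF xy]] amalg_mult_class[of "[Inl x]" "[Inl y]"] xy
    by (auto simp: amalg_inl_def)
qed

lemma amalg_inr_hom: "amalg_inr A B H \<phi> \<in> hom B (amalg_product A B H \<phi>)"
proof (rule homI)
  fix x y assume xy: "x \<in> carrier B" "y \<in> carrier B"
  show "amalg_inr A B H \<phi> x \<in> carrier (amalg_product A B H \<phi>)"
    unfolding amalg_inr_def using xy by (intro amalg_class_carrier) auto
  show "amalg_inr A B H \<phi> (x \<otimes>\<^bsub>B\<^esub> y) =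
      amalg_inr A B H \<phi> x \<otimes>\<^bsub>amalg_product A B H \<phi>\<^esub> amalg_inr A B H \<phi> y"
    using amalg_class_eq[OF amalg_cong.mult_B[OF xy]] amalg_mult_class[of "[Inr x]" "[Inr y]"] xy
    by (auto simp: amalg_inr_def)
qed

lemma amalg_inl_inr: "h \<in> H \<Longrightarrow> amalg_inl A B H \<phi> h = amalg_inr A B H \<phi> (\<phi> h)"
  unfolding amalg_inl_def amalg_inr_def by (rule amalg_class_eq[OF amalg_cong.amalg])

lemma amalg_product_lift:
  fixes L :: "('c, 'l) monoid_scheme"
  assumes L: "group L" and f: "f \<in> hom A L" and g: "g \<in> hom B L"
    and fg: "\<And>h. h \<in> H \<Longrightarrow> f h = g (\<phi> h)"
  shows "\<exists>F\<in>hom (amalg_product A B H \<phi>) L.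
    (\<forall>a\<in>carrier A. F (amalg_inl A B H \<phi> a) = f a) \<and>
    (\<forall>b\<in>carrier B. F (amalg_inr A B H \<phi> b) = g b)"
proof -
  interpret L: group L by (rule L)
  let ?W = "lists (carrier A <+> carrier B)"
  define e where "e u = foldr (\<lambda>x y. case_sum f g x \<otimes>\<^bsub>L\<^esub> y) u \<one>\<^bsub>L\<^esub>" for u
  define F where "F U = e (SOME u. u \<in> U)" for U
  have letter: "case_sum f g x \<in> carrier L" if "x \<in> carrier A <+> carrier B" for x
    using that f g by (auto simp: hom_def)
  have eW: "e u \<in> carrier L" if "u \<in> ?W" for u
    using that by (induction u) (auto simp: e_def simp del: Plus_def intro!: L.m_closed letter)
  have eCons: "e (x # u) = case_sum f g x \<otimes>\<^bsub>L\<^esub> e u" for x u by (simp add: e_def)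
  have eNil: "e [] = \<one>\<^bsub>L\<^esub>" by (simp add: e_def)
  have eapp: "e (u @ v) = e u \<otimes>\<^bsub>L\<^esub> e v" if "u \<in> ?W" "v \<in> ?W" for u v
    using that(1)
  proof (induction u)
    case Nil
    then show ?case using eW[OF that(2)] by (simp add: eNil)
  next
    case (Cons x u)
    then show ?case
      using eW[OF that(2)] eW[of u] letter[of x] by (simp add: eCons L.m_assoc)
  qed
  have f1: "f \<one>\<^bsub>A\<^esub> = \<one>\<^bsub>L\<^esub>" by (rule hom_one[OF f A L])
  have g1: "g \<one>\<^bsub>B\<^esub> = \<one>\<^bsub>L\<^esub>" by (rule hom_one[OF g B L])
  have fc: "f a \<in> carrier L" if "a \<in> carrier A" for a using f that by (auto simp: hom_def)
  have gc: "g b \<in> carrier L" if "b \<in> carrier B" for b using g that by (auto simp: hom_def)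
  have HA: "h \<in> carrier A" if "h \<in> H" for h using that subgroup.subset[OF H] by blast
  have econg: "e u = e v" if "(u, v) \<in> amalg_cong A B H \<phi>" for u v
    using that
  proof (induction rule: amalg_cong.induct)
    case (append u u' v v')
    then show ?case using amalg_cong_words eapp by metis
  next
    case (amalg h)
    then show ?case using fg[of h] by (simp add: eCons eNil)
  qed (simp_all add: eCons eNil f1 g1 fc gc hom_mult[OF f] hom_mult[OF g])
  have Fc: "F (amalg_cong A B H \<phi> `` {u}) = e u" if "u \<in> ?W" for u
  proof -
    have "u \<in> amalg_cong A B H \<phi> `` {u}" using that by (auto intro: amalg_cong.refl)
    then have "(SOME x. x \<in> amalg_cong A B H \<phi> `` {u}) \<in> amalg_cong A B H \<phi> `` {u}"
      by (rule someI)
    then show ?thesis unfolding F_def using econg by auto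
  qed
  have "F \<in> hom (amalg_product A B H \<phi>) L"
  proof (rule homI)
    fix U V assume U: "U \<in> carrier (amalg_product A B H \<phi>)"
    obtain u where u: "u \<in> ?W" "U = amalg_cong A B H \<phi> `` {u}"
      using U by (rule amalg_carrierE)
    show "F U \<in> carrier L" using Fc[OF u(1)] eW[OF u(1)] u(2) by simp
    assume V: "V \<in> carrier (amalg_product A B H \<phi>)"
    obtain v where v: "v \<in> ?W" "V = amalg_cong A B H \<phi> `` {v}"
      using V by (rule amalg_carrierE)
    have "u @ v \<in> ?W" using u(1) v(1) by auto
    then show "F (U \<otimes>\<^bsub>amalg_product A B H \<phi>\<^esub> V) = F U \<otimes>\<^bsub>L\<^esub> F V"
      unfolding u(2) v(2) amalg_mult_class[OF u(1) v(1)]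
      by (simp only: Fc u(1) v(1) eapp)
  qed
  moreover have "F (amalg_inl A B H \<phi> a) = f a" if "a \<in> carrier A" for a
    using that fc unfolding amalg_inl_def by (subst Fc) (auto simp: eCons eNil)
  moreover have "F (amalg_inr A B H \<phi> b) = g b" if "b \<in> carrier B" for b
    using that gc unfolding amalg_inr_def by (subst Fc) (auto simp: eCons eNil)
  ultimately show ?thesis by blast
qed

lemma amalg_product_lift_unique:
  fixes L :: "('c, 'l) monoid_scheme"
  assumes L: "group L" and F: "F \<in> hom (amalg_product A B H \<phi>) L"
    and F': "F' \<in> hom (amalg_product A B H \<phi>) L"
    and a: "\<And>a. a \<in> carrier A \<Longrightarrow> F (amalg_inl A B H \<phi> a) = F' (amalg_inl A B H \<phi> a)"
    and b: "\<And>b. b \<in> carrier B \<Longrightarrow> F (amalg_inr A B H \<phi> b) = F' (amalg_inr A B H \<phi> b)"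
    and U: "U \<in> carrier (amalg_product A B H \<phi>)"
  shows "F U = F' U"
proof -
  let ?W = "lists (carrier A <+> carrier B)"
  let ?G = "amalg_product A B H \<phi>"
  have "F (amalg_cong A B H \<phi> `` {u}) = F' (amalg_cong A B H \<phi> `` {u})" if "u \<in> ?W" for u
    using that
  proof (induction u)
    case Nil
    have "amalg_cong A B H \<phi> `` {[]} = \<one>\<^bsub>?G\<^esub>" by (simp add: amalg_product_def)
    then show ?case
      using hom_one[OF F group_amalg_product L] hom_one[OF F' group_amalg_product L] by simp
  next
    case (Cons x u)
    have x: "[x] \<in> ?W" and u: "u \<in> ?W" using Cons.hyps by auto
    have "F (amalg_cong A B H \<phi> `` {[x]}) = F' (amalg_cong A B H \<phi> `` {[x]})"
      using Cons.hyps(1) a b by (auto simp: amalg_inl_def amalg_inr_def)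
    then show ?case
      using Cons.IH amalg_mult_class[OF x u]
        hom_mult[OF F amalg_class_carrier[OF x] amalg_class_carrier[OF u]]
        hom_mult[OF F' amalg_class_carrier[OF x] amalg_class_carrier[OF u]]
      by simp
  qed
  then show ?thesis using U by (metis amalg_carrierE)
qed

end

end

theory Submission
  imports Defs "HOL-Algebra.Multiplicative_Group" "HOL-Algebra.Bij"
begin

text \<open>Fix \<^term>\<open>g\<close> outside the cyclic subgroup generated by \<^term>\<open>c\<close>.  A compatible pair
\<open>(R, S)\<close> of normal subgroups makes \<open>\<phi>\<close> induce an isomorphism between the images of \<open>H\<close> in
\<open>A/R\<close> and of \<open>K\<close> in \<open>B/S\<close>, and so gives a homomorphism \<open>\<rho>\<close> from \<open>G\<close> to the amalgam \<open>G\<^sub>R\<^sub>S\<close>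
of \<open>A/R\<close> and \<open>B/S\<close>.  Two facts prove the theorem: in an amalgam of finite groups every cyclic
subgroup is finitely separable, and some \<open>(R, S)\<close> in \<open>\<Omega>\<close> keeps \<open>\<rho> g\<close> outside the subgroup
generated by \<open>\<rho> c\<close>.

\<^bold>\<open>Amalgams of finite groups\<close> (\<open>finite_amalgam_cyclic_separable\<close>).  Let \<open>N\<close> be a subgroup of
\<open>G\<close> that meets every conjugate of \<open>A\<close> and of \<open>B\<close> trivially.  Then \<open>A\<close> and \<open>B\<close> act freely on
the cosets of \<open>N\<close>, and any finite part of such a \<open>G\<close>-set sits inside a finite \<open>G\<close>-set
(\<open>finite_extension\<close>); hence finitely many cosets of \<open>N\<close> can be told apart in a finite
permutation group.  For a cyclic subgroup \<open>C\<close> take \<open>N = C\<close> if \<open>C\<close> is infinite, because then no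
nontrivial element of \<open>C\<close> has finite order, and \<open>N = 1\<close> if \<open>C\<close> is finite.

\<^bold>\<open>The choice of the pair.\<close>  A reduced word determines the sides of the syllables of the
element that it represents (\<open>syllables_reduced\<close>).  Because \<open>\<Omega>\<^sub>A\<close> is an \<open>H\<close>-filtration and
\<open>\<Omega>\<^sub>B\<close> a \<open>K\<close>-filtration, and \<open>\<Omega>\<close> is closed under intersections, finitely many reduced words
stay reduced, and finitely many nontrivial elements stay nontrivial, modulo one pair from \<open>\<Omega>\<close>.
Replace \<open>c\<close> by a conjugate that is represented by as short a word as possible.

If this word is a single letter, say \<open>a\<close> in \<open>A\<close>, there are two cases.  An element \<open>g\<close> outside
\<open>A\<close> remains outside by its syllables.  For \<open>g\<close> in \<open>A\<close>, the subgroup generated by \<open>a\<close> is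
separable by \<open>\<Omega>\<^sub>A\<close>, as it would otherwise belong to \<open>\<Lambda>\<^sub>A\<close>; this yields the pair.

Otherwise the word is cyclically reduced, and the \<open>m\<close>-th power of \<open>c\<close> has \<open>\<bar>m\<bar>\<close> times as many
syllables as \<open>c\<close>, in \<open>G\<close> as well as in \<open>G\<^sub>R\<^sub>S\<close>.  Counting syllables leaves at most one \<open>m\<close> up to
sign for which \<open>\<rho> g\<close> may equal the \<open>m\<close>-th power of \<open>\<rho> c\<close>, and that is excluded by keeping the
nontrivial elements \<open>g c\<^sup>-\<^sup>m\<close> and \<open>g\<^sup>-\<^sup>1 c\<^sup>-\<^sup>m\<close> nontrivial.\<close>

section \<open>Group actions and coset representatives\<close>

text \<open>Actions are not required to be extensional, unlike \<^term>\<open>BijGroup\<close>-valued homomorphisms: the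
actions below are patched together from pieces, and \<open>restrict_act_hom\<close> passes to the
permutation group at the end.\<close>
locale set_action = group X for X :: "('x, 'm) monoid_scheme" (structure) +
  fixes Y :: "'y set" and f :: "'x \<Rightarrow> 'y \<Rightarrow> 'y"
  assumes act_closed: "x \<in> carrier X \<Longrightarrow> y \<in> Y \<Longrightarrow> f x y \<in> Y"
    and act_one: "y \<in> Y \<Longrightarrow> f \<one> y = y"
    and act_mult: "x \<in> carrier X \<Longrightarrow> x' \<in> carrier X \<Longrightarrow> y \<in> Y \<Longrightarrow> f (x \<otimes> x') y = f x (f x' y)"
begin

lemma act_inv: "x \<in> carrier X \<Longrightarrow> y \<in> Y \<Longrightarrow> f (inv x) (f x y) = y"
  by (metis act_mult act_one inv_closed l_inv)

lemma act_inv': "x \<in> carrier X \<Longrightarrow> y \<in> Y \<Longrightarrow> f x (f (inv x) y) = y"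
  by (metis act_mult act_one inv_closed r_inv)

lemma restrict_act_hom: "(\<lambda>x. restrict (f x) Y) \<in> hom X (BijGroup Y)"
proof (rule homI)
  have Bij: "restrict (f x) Y \<in> Bij Y" if "x \<in> carrier X" for x
  proof -
    have "bij_betw (f x) Y Y"
      by (rule bij_betw_byWitness[where f' = "f (inv x)"])
        (use that in \<open>auto simp: act_inv act_inv' act_closed\<close>)
    then show ?thesis by (simp add: Bij_def)
  qed
  show "restrict (f x) Y \<in> carrier (BijGroup Y)" if "x \<in> carrier X" for x
    using Bij[OF that] by (simp add: BijGroup_def)
  show "restrict (f (x \<otimes> x')) Y =
      restrict (f x) Y \<otimes>\<^bsub>BijGroup Y\<^esub> restrict (f x') Y"
    if "x \<in> carrier X" "x' \<in> carrier X" for x x'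
    using that Bij by (auto simp: BijGroup_def compose_def act_mult act_closed)
qed

end

lemma (in group) subgroup_mult_mem_iff:
  assumes "subgroup J G" "j \<in> J" "x \<in> carrier G"
  shows "j \<otimes> x \<in> J \<longleftrightarrow> x \<in> J" "x \<otimes> j \<in> J \<longleftrightarrow> x \<in> J"
proof -
  interpret J: subgroup J G by fact
  have "inv j \<otimes> (j \<otimes> x) = x" "(x \<otimes> j) \<otimes> inv j = x"
    using assms by (simp_all add: inv_solve_right' m_assoc[symmetric])
  then show "j \<otimes> x \<in> J \<longleftrightarrow> x \<in> J" "x \<otimes> j \<in> J \<longleftrightarrow> x \<in> J"
    using assms(2) by (metis J.m_closed J.m_inv_closed)+
qed

text \<open>A right transversal of \<^term>\<open>J\<close> with \<open>1\<close> as the representative of \<^term>\<open>J\<close> itself, so that a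
letter belongs to \<^term>\<open>J\<close> exactly if it leaves no representative behind.\<close>
definition coset_rep :: "('x, 'm) monoid_scheme \<Rightarrow> 'x set \<Rightarrow> 'x \<Rightarrow> 'x" where
  "coset_rep X J x = (if x \<in> J then \<one>\<^bsub>X\<^esub> else SOME y. y \<in> J #>\<^bsub>X\<^esub> x)"

lemma (in group) coset_rep_props:
  assumes "subgroup J G" "x \<in> carrier G"
  shows "coset_rep G J x \<in> carrier G"
    and "x \<otimes> inv (coset_rep G J x) \<in> J"
    and "j \<in> J \<Longrightarrow> coset_rep G J (j \<otimes> x) = coset_rep G J x"
    and "x \<notin> J \<Longrightarrow> coset_rep G J x \<notin> J"
    and "coset_rep G J (coset_rep G J x) = coset_rep G J x"
proof -
  interpret J: subgroup J G by fact
  have mult: "coset_rep G J (j \<otimes> x) = coset_rep G J x" if j: "j \<in> J" for j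
  proof -
    have "j \<otimes> x \<in> J \<longleftrightarrow> x \<in> J"
      using j assms by (simp add: subgroup_mult_mem_iff)
    moreover have "J #> (j \<otimes> x) = J #> x"
      using j assms coset_mult_assoc[of J j x] by (simp add: J.subset J.rcos_const is_group)
    ultimately show ?thesis by (simp add: coset_rep_def)
  qed
  have ex: "\<exists>j\<in>J. coset_rep G J x = j \<otimes> x"
  proof (cases "x \<in> J")
    case True
    then show ?thesis
      using assms(2) by (intro bexI[of _ "inv x"]) (auto simp: coset_rep_def)
  next
    case False
    have "x \<in> J #> x" using assms by (simp add: rcos_self)
    then have "(SOME y. y \<in> J #> x) \<in> J #> x" by (rule someI)
    then show ?thesis using False by (auto simp: coset_rep_def r_coset_def)
  qed
  then obtain j where j: "j \<in> J" "coset_rep G J x = j \<otimes> x" by blast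
  show "coset_rep G J x \<in> carrier G" using j assms(2) by simp
  show "x \<otimes> inv (coset_rep G J x) \<in> J"
    using j assms(2) by (simp add: inv_mult_group m_assoc[symmetric])
  show "coset_rep G J x \<notin> J" if "x \<notin> J"
    using that j assms by (simp add: subgroup_mult_mem_iff)
  show "coset_rep G J (coset_rep G J x) = coset_rep G J x"
    using j mult by metis
  show "j \<in> J \<Longrightarrow> coset_rep G J (j \<otimes> x) = coset_rep G J x" for j by (rule mult)
qed

section \<open>The action of a factor on normal forms\<close>

text \<open>Van der Waerden's argument for the normal form theorem lets both factors of an amalgam act on
the set of normal forms \<open>p t\<^sub>1 \<dots> t\<^sub>n\<close> with \<open>p\<close> in the amalgamated subgroup and coset
representatives \<open>t\<^sub>i\<close> outside it, from alternating sides.  This locale is one side of it: a factor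
\<^term>\<open>X\<close> with subgroup \<^term>\<open>J\<close> identified with \<^term>\<open>P\<close> by \<^term>\<open>\<iota>\<close>.  The letters of the
other factor appear only as list elements not built by \<^term>\<open>tag\<close>, and the assumption
\<open>N_tag\<close> is all that this side knows about the set \<^term>\<open>N\<close> of admissible lists.\<close>

locale normal_form_action = X: group X + J: subgroup J X + P: group P
  for X :: "('x, 'm) monoid_scheme" and J :: "'x set" and P :: "('p, 'k) monoid_scheme" +
  fixes \<iota> :: "'p \<Rightarrow> 'x" and tag :: "'x \<Rightarrow> 'l" and N :: "'l list set"
  assumes \<iota>: "\<iota> \<in> iso P (X\<lparr>carrier := J\<rparr>)"
    and tag: "inj tag"
    and N_tag: "tag t # l \<in> N \<longleftrightarrow>
      t \<in> coset_rep X J ` (carrier X - J) \<and> l \<in> N \<and> (l = [] \<or> hd l \<notin> range tag)"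
begin

definition N0 :: "'l list set" where
  "N0 = {l \<in> N. l = [] \<or> hd l \<notin> range tag}"

text \<open>The normal form of \<open>x\<close> times a list, where the list does not begin on the side of
\<^term>\<open>X\<close>.  It is a bijection (\<open>push_bij\<close>) from pairs on which \<^term>\<open>X\<close> acts by left
multiplication, which makes \<open>act\<close> an action without any calculation with normal forms.\<close>
definition push :: "'x \<times> 'l list \<Rightarrow> 'p \<times> 'l list" where
  "push = (\<lambda>(x, l). (inv_into (carrier P) \<iota> (x \<otimes>\<^bsub>X\<^esub> inv\<^bsub>X\<^esub> (coset_rep X J x)),
     if x \<in> J then l else tag (coset_rep X J x) # l))"

definition act :: "'x \<Rightarrow> 'p \<times> 'l list \<Rightarrow> 'p \<times> 'l list" where
  "act a w = (case inv_into (carrier X \<times> N0) push w of (x, l) \<Rightarrow> push (a \<otimes>\<^bsub>X\<^esub> x, l))"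

lemma \<iota>_bij: "bij_betw \<iota> (carrier P) J"
  using \<iota> by (simp add: iso_def)

lemma \<iota>_closed: "p \<in> carrier P \<Longrightarrow> \<iota> p \<in> J"
  using \<iota>_bij by (auto simp: bij_betw_def)

lemma \<iota>_mult: "p \<in> carrier P \<Longrightarrow> q \<in> carrier P \<Longrightarrow> \<iota> (p \<otimes>\<^bsub>P\<^esub> q) = \<iota> p \<otimes>\<^bsub>X\<^esub> \<iota> q"
  using \<iota> by (simp add: iso_def hom_def)

lemma \<iota>_inv: "j \<in> J \<Longrightarrow> \<iota> (inv_into (carrier P) \<iota> j) = j"
  using \<iota>_bij by (auto simp: bij_betw_def f_inv_into_f)

lemma inv_\<iota>: "p \<in> carrier P \<Longrightarrow> inv_into (carrier P) \<iota> (\<iota> p) = p"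
  using \<iota>_bij by (auto simp: bij_betw_def inv_into_f_f)

lemma inv_\<iota>_closed: "j \<in> J \<Longrightarrow> inv_into (carrier P) \<iota> j \<in> carrier P"
  using \<iota>_bij by (auto simp: bij_betw_def inv_into_into)

lemma inv_\<iota>_mult:
  assumes "j \<in> J" "k \<in> J"
  shows "inv_into (carrier P) \<iota> (j \<otimes>\<^bsub>X\<^esub> k) =
    inv_into (carrier P) \<iota> j \<otimes>\<^bsub>P\<^esub> inv_into (carrier P) \<iota> k"
  using inv_\<iota>[of "inv_into (carrier P) \<iota> j \<otimes>\<^bsub>P\<^esub> inv_into (carrier P) \<iota> k"] assms
  by (simp add: \<iota>_inv \<iota>_mult inv_\<iota>_closed)

lemmas J_mult_mem = X.subgroup_mult_mem_iff[OF J.subgroup_axioms]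

lemmas rep_props = X.coset_rep_props[OF J.subgroup_axioms]

lemma push_bij: "bij_betw push (carrier X \<times> N0) (carrier P \<times> N)"
proof (rule bij_betw_imageI)
  show "inj_on push (carrier X \<times> N0)"
  proof (rule inj_onI)
    fix z z' assume z: "z \<in> carrier X \<times> N0" "z' \<in> carrier X \<times> N0" and zz': "push z = push z'"
    obtain x l x' l' where xl: "z = (x, l)" "z' = (x', l')" by fastforce
    have x: "x \<in> carrier X" "x' \<in> carrier X" and l: "l \<in> N0" "l' \<in> N0"
      and eq: "push (x, l) = push (x', l')"
      using z zz' xl by auto
    have J: "x \<in> J \<longleftrightarrow> x' \<in> J" and l': "l = l'"
      and rep: "coset_rep X J x = coset_rep X J x'"
      using eq l injD[OF tag]
      by (auto simp: push_def N0_def coset_rep_def split: if_splits)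
    have "\<iota> (fst (push (x, l))) = \<iota> (fst (push (x', l')))" using eq by simp
    then have "x \<otimes>\<^bsub>X\<^esub> inv\<^bsub>X\<^esub> (coset_rep X J x) = x' \<otimes>\<^bsub>X\<^esub> inv\<^bsub>X\<^esub> (coset_rep X J x')"
      using x by (simp add: push_def \<iota>_inv rep_props(2))
    then have "x = x'"
      using x rep rep_props(1) by (metis X.inv_closed X.right_cancel)
    then show "z = z'" using l' xl by simp
  qed
  show "push ` (carrier X \<times> N0) = carrier P \<times> N"
  proof (intro equalityI subsetI)
    fix w assume "w \<in> push ` (carrier X \<times> N0)"
    then obtain x l where x: "x \<in> carrier X" "l \<in> N0" "w = push (x, l)" by blast
    have "tag (coset_rep X J x) # l \<in> N" if "x \<notin> J"
      using that x by (auto simp: N_tag N0_def)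
    then show "w \<in> carrier P \<times> N"
      using x inv_\<iota>_closed[OF rep_props(2)[of x]] by (auto simp: push_def N0_def split: if_splits)
  next
    fix w assume "w \<in> carrier P \<times> N"
    then obtain p l where w: "w = (p, l)" and p: "p \<in> carrier P" and l: "l \<in> N" by blast
    have \<iota>p: "\<iota> p \<in> J" using \<iota>_closed[OF p] .
    show "w \<in> push ` (carrier X \<times> N0)"
    proof (cases "l \<in> N0")
      case True
      then show ?thesis
        using p \<iota>p by (intro image_eqI[of _ _ "(\<iota> p, l)"]) (auto simp: w push_def coset_rep_def inv_\<iota>)
    next
      case False
      then obtain t l' where l': "l = tag t # l'" using l
        by (cases l) (auto simp: N0_def)
      then obtain x where x: "x \<in> carrier X" "x \<notin> J" "t = coset_rep X J x" "l' \<in> N0"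
        using l by (auto simp: N_tag N0_def)
      have t: "t \<in> carrier X" "t \<notin> J" "coset_rep X J t = t"
        using x rep_props by auto
      have nin: "\<iota> p \<otimes>\<^bsub>X\<^esub> t \<notin> J"
        using \<iota>p t by (simp add: J_mult_mem)
      have "push (\<iota> p \<otimes>\<^bsub>X\<^esub> t, l') = w"
        using \<iota>p t nin p l' w by (simp add: push_def rep_props(3) X.m_assoc inv_\<iota>)
      then show ?thesis using \<iota>p t(1) x(4) by (metis J.mem_carrier X.m_closed image_eqI mem_Sigma_iff)
    qed
  qed
qed

lemma act_push: "x \<in> carrier X \<Longrightarrow> l \<in> N0 \<Longrightarrow> act a (push (x, l)) = push (a \<otimes>\<^bsub>X\<^esub> x, l)"
  using push_bij by (simp add: act_def bij_betw_def)

lemma pushE: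
  assumes "w \<in> carrier P \<times> N"
  obtains x l where "x \<in> carrier X" "l \<in> N0" "w = push (x, l)"
  using assms bij_betw_imp_surj_on[OF push_bij] by blast

lemma push_closed: "x \<in> carrier X \<Longrightarrow> l \<in> N0 \<Longrightarrow> push (x, l) \<in> carrier P \<times> N"
  using push_bij unfolding bij_betw_def by blast

sublocale set_action X "carrier P \<times> N" act
proof
  fix x w assume x: "x \<in> carrier X" and w: "w \<in> carrier P \<times> N"
  show "act x w \<in> carrier P \<times> N"
    using w by (rule pushE) (use x in \<open>simp add: act_push push_closed del: mem_Sigma_iff\<close>)
next
  fix w assume w: "w \<in> carrier P \<times> N"
  show "act \<one>\<^bsub>X\<^esub> w = w"
    using w by (rule pushE) (simp add: act_push)
next
  fix x x' w assume x: "x \<in> carrier X" "x' \<in> carrier X" and w: "w \<in> carrier P \<times> N"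
  show "act (x \<otimes>\<^bsub>X\<^esub> x') w = act x (act x' w)"
    using w by (rule pushE) (use x in \<open>simp add: act_push X.m_assoc\<close>)
qed

text \<open>On the amalgamated subgroup the action does not touch the list.  The same formula on the other
side is the reason why the two factors agree there.\<close>
lemma act_J:
  assumes j: "j \<in> J" and w: "p \<in> carrier P" "l \<in> N"
  shows "act j (p, l) = (inv_into (carrier P) \<iota> j \<otimes>\<^bsub>P\<^esub> p, l)"
proof -
  obtain x l0 where x: "x \<in> carrier X" "l0 \<in> N0" "(p, l) = push (x, l0)"
    by (rule pushE[of "(p, l)"]) (use w in auto)
  have "j \<otimes>\<^bsub>X\<^esub> x \<in> J \<longleftrightarrow> x \<in> J"
    using j x(1) by (simp add: J_mult_mem)
  then have "push (j \<otimes>\<^bsub>X\<^esub> x, l0) = (inv_into (carrier P) \<iota> j \<otimes>\<^bsub>P\<^esub> p, l)"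
    using j x rep_props(1,2,3)[OF x(1)] by (simp add: push_def inv_\<iota>_mult X.m_assoc)
  then show ?thesis using act_push[OF x(1,2)] x(3) by simp
qed

text \<open>A letter outside \<^term>\<open>J\<close> in front of a list from the other side adds one syllable; this is
the step that counts the letters of a reduced word.\<close>
lemma act_outside_J:
  assumes x: "x \<in> carrier X" "x \<notin> J" and w: "p \<in> carrier P" "l \<in> N0"
  shows "\<exists>q t. act x (p, l) = (q, tag t # l)"
proof -
  have \<iota>p: "\<iota> p \<in> J" by (rule \<iota>_closed[OF w(1)])
  have "push (\<iota> p, l) = (p, l)"
    using \<iota>p inv_\<iota>[OF w(1)] by (simp add: push_def coset_rep_def)
  then have "act x (p, l) = push (x \<otimes>\<^bsub>X\<^esub> \<iota> p, l)"
    using act_push[OF J.mem_carrier[OF \<iota>p] w(2), of x] by (simp only:)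
  moreover have "x \<otimes>\<^bsub>X\<^esub> \<iota> p \<notin> J"
    using x \<iota>p by (simp add: J_mult_mem)
  ultimately show ?thesis by (auto simp: push_def)
qed

end

section \<open>Reduced words in an amalgamated product\<close>

definition reduced_word :: "'a set \<Rightarrow> 'b set \<Rightarrow> ('a + 'b) list \<Rightarrow> bool" where
  "reduced_word H K u \<longleftrightarrow> distinct_adj (map isl u) \<and> set u \<inter> (H <+> K) = {}"

lemma tagged_in_Plus [simp]:
  "Inl a \<in> X <+> Y \<longleftrightarrow> a \<in> X" "Inr b \<in> X <+> Y \<longleftrightarrow> b \<in> Y"
  by auto

locale amalgam = A: group A + B: group B + H: subgroup H A + K: subgroup K B
  for A :: "('a, 'm) monoid_scheme" and B :: "('b, 'n) monoid_scheme"
    and H :: "'a set" and K :: "'b set" +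
  fixes \<phi> :: "'a \<Rightarrow> 'b"
  assumes \<phi>: "\<phi> \<in> iso (A\<lparr>carrier := H\<rparr>) (B\<lparr>carrier := K\<rparr>)"
begin

abbreviation G :: "('a + 'b) list set monoid" where
  "G \<equiv> amalg_product A B H \<phi>"

abbreviation words :: "('a + 'b) list set" where
  "words \<equiv> lists (carrier A <+> carrier B)"

abbreviation cls :: "('a + 'b) list \<Rightarrow> ('a + 'b) list set" where
  "cls u \<equiv> amalg_cong A B H \<phi> `` {u}"

lemmas amalgam_data = A.group_axioms B.group_axioms H.subgroup_axioms K.subgroup_axioms \<phi>

sublocale G: group G
  by (rule group_amalg_product[OF amalgam_data])

lemma one_cls: "\<one>\<^bsub>G\<^esub> = cls []"
  by (simp add: amalg_product_def)

lemmas cls_carrier = amalg_class_carrier[OF amalgam_data]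
lemmas cls_mult = amalg_mult_class[OF amalgam_data]
lemmas cls_eqI = amalg_class_eq[OF amalgam_data]

lemma cls_eq_iff: "u \<in> words \<Longrightarrow> v \<in> words \<Longrightarrow> cls u = cls v \<longleftrightarrow> (u, v) \<in> amalg_cong A B H \<phi>"
  by (rule eq_equiv_class_iff[OF equiv_amalg_cong[OF amalgam_data]])

lemma carrierE:
  assumes "g \<in> carrier G"
  obtains u where "u \<in> words" "g = cls u"
  using assms by (rule amalg_carrierE[OF amalgam_data])

lemma cls_self: "u \<in> words \<Longrightarrow> u \<in> cls u"
  by (auto intro: amalg_cong.refl)

lemma \<phi>_bij: "bij_betw \<phi> H K"
  using \<phi> by (simp add: iso_def)

lemma \<phi>_K: "h \<in> H \<Longrightarrow> \<phi> h \<in> K"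
  using \<phi>_bij by (auto simp: bij_betw_def)

lemma \<phi>_surjE:
  assumes "k \<in> K"
  obtains h where "h \<in> H" "k = \<phi> h"
  using assms bij_betw_imp_surj_on[OF \<phi>_bij] by blast

lemma \<phi>_mult: "h \<in> H \<Longrightarrow> k \<in> H \<Longrightarrow> \<phi> (h \<otimes>\<^bsub>A\<^esub> k) = \<phi> h \<otimes>\<^bsub>B\<^esub> \<phi> k"
  using \<phi> by (simp add: iso_def hom_def)

lemma \<phi>_one: "\<phi> \<one>\<^bsub>A\<^esub> = \<one>\<^bsub>B\<^esub>"
  using \<phi>_mult[of "\<one>\<^bsub>A\<^esub>" "\<one>\<^bsub>A\<^esub>"] \<phi>_K[of "\<one>\<^bsub>A\<^esub>"]
  by (metis B.l_cancel_one' B.l_cancel_one A.l_one A.one_closed H.one_closed K.mem_carrier)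

lemma cls_amalg: "h \<in> H \<Longrightarrow> cls [Inl h] = cls [Inr (\<phi> h)]"
  by (rule cls_eqI[OF amalg_cong.amalg])

definition normal_lists :: "('a + 'b) list set" where
  "normal_lists = {l. distinct_adj (map isl l) \<and>
     set l \<subseteq> coset_rep A H ` (carrier A - H) <+> coset_rep B K ` (carrier B - K)}"

lemma isl_notin: "x \<notin> range Inl \<longleftrightarrow> \<not> isl x" "x \<notin> range Inr \<longleftrightarrow> isl x"
  by (cases x; auto)+

lemma group_H: "group (A\<lparr>carrier := H\<rparr>)"
  by (rule A.subgroup_imp_group[OF H.subgroup_axioms])

lemma Cons_normal:
  "x # l \<in> normal_lists \<longleftrightarrow> x \<in> coset_rep A H ` (carrier A - H) <+> coset_rep B K ` (carrier B - K) \<and>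
     l \<in> normal_lists \<and> (l = [] \<or> isl (hd l) \<noteq> isl x)"
  by (cases l) (auto simp: normal_lists_def)

interpretation nA: normal_form_action A H "A\<lparr>carrier := H\<rparr>" "\<lambda>a. a" Inl normal_lists
  by (intro normal_form_action.intro normal_form_action_axioms.intro group_H
      A.group_axioms H.subgroup_axioms iso_set_refl inj_Inl)
    (auto simp: Cons_normal isl_notin)

interpretation nB: normal_form_action B K "A\<lparr>carrier := H\<rparr>" \<phi> Inr normal_lists
  by (intro normal_form_action.intro normal_form_action_axioms.intro group_H
      B.group_axioms K.subgroup_axioms \<phi> inj_Inr)
    (auto simp: Cons_normal isl_notin)

lemma Nil_normal [simp]: "[] \<in> normal_lists"
  by (simp add: normal_lists_def)

abbreviation states :: "('a \<times> ('a + 'b) list) set" where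
  "states \<equiv> H \<times> normal_lists"

abbreviation letter_act :: "'a + 'b \<Rightarrow> 'a \<times> ('a + 'b) list \<Rightarrow> 'a \<times> ('a + 'b) list" where
  "letter_act \<equiv> case_sum nA.act nB.act"

lemma states_eq: "carrier (A\<lparr>carrier := H\<rparr>) \<times> normal_lists = states"
  by simp

lemma letter_act_closed:
  "x \<in> carrier A <+> carrier B \<Longrightarrow> w \<in> states \<Longrightarrow> letter_act x w \<in> states"
  using nA.act_closed[of _ w] nB.act_closed[of _ w] unfolding states_eq by (elim PlusE) simp_all

lemma word_act_closed: "u \<in> words \<Longrightarrow> w \<in> states \<Longrightarrow> foldr letter_act u w \<in> states"
  by (induction u) (auto simp del: mem_Sigma_iff Plus_def intro!: letter_act_closed)

text \<open>Both factors act on the same set and agree on the amalgamated subgroup, so the action of a word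
depends only on the element of \<^term>\<open>G\<close> that it represents.\<close>
lemma word_act_cong:
  assumes "(u, v) \<in> amalg_cong A B H \<phi>" "w \<in> states"
  shows "foldr letter_act u w = foldr letter_act v w"
  using assms
proof (induction arbitrary: w rule: amalg_cong.induct)
  case (append u u' v v')
  have "foldr letter_act v' w \<in> states"
    using word_act_closed[OF _ append.prems] amalg_cong_words[OF amalgam_data append.hyps(2)] by blast
  then show ?case using append by simp
next
  case one_A
  then show ?case using nA.act_one by simp
next
  case one_B
  then show ?case using nB.act_one by simp
next
  case (mult_A x y)
  then show ?case using nA.act_mult[of x y w] by simp
next
  case (mult_B x y)
  then show ?case using nB.act_mult[of x y w] by simp
next
  case (amalg h)
  obtain p l where w: "w = (p, l)" "p \<in> H" "l \<in> normal_lists" using amalg.prems by blast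
  have "nB.act (\<phi> h) (p, l) = nA.act h (p, l)"
    using amalg.hyps w nB.act_J[of "\<phi> h" p l] nA.act_J[of h p l] \<phi>_K nB.inv_\<iota> nA.inv_\<iota> by simp
  then show ?case using w by simp
qed simp_all

text \<open>The sides of the syllables of an element, read off its normal form: \<^term>\<open>True\<close> for
\<^term>\<open>A\<close>.  The normal form is the image of the empty normal form under the action.\<close>
definition syllables :: "('a + 'b) list set \<Rightarrow> bool list" where
  "syllables X = map isl (snd (foldr letter_act (SOME u. u \<in> X) (\<one>\<^bsub>A\<^esub>, [])))"

lemma base_state: "(\<one>\<^bsub>A\<^esub>, []) \<in> states"
  by simp

lemma syllables_cls:
  assumes "u \<in> words"
  shows "syllables (cls u) = map isl (snd (foldr letter_act u (\<one>\<^bsub>A\<^esub>, [])))"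
proof -
  have "(SOME v. v \<in> cls u) \<in> cls u"
    using cls_self[OF assms] by (rule someI)
  then show ?thesis
    using word_act_cong[OF _ base_state, of u "SOME v. v \<in> cls u"] by (simp add: syllables_def)
qed

text \<open>Every letter of a reduced word meets a list that begins on the other side, so each of them adds a
syllable and none is absorbed.\<close>
lemma word_act_reduced:
  assumes "u \<in> words" "reduced_word H K u" "w \<in> states" "snd w = []"
  shows "map isl (snd (foldr letter_act u w)) = map isl u"
  using assms(1,2)
proof (induction u)
  case Nil
  then show ?case using assms(4) by simp
next
  case (Cons x u)
  have IH: "map isl (snd (foldr letter_act u w)) = map isl u"
    using Cons by (auto simp: reduced_word_def distinct_adj_Cons)
  obtain p l where pl: "foldr letter_act u w = (p, l)" by fastforce
  have st: "p \<in> H" "l \<in> normal_lists"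
    using word_act_closed[of u w] Cons.prems(1) Cons.hyps assms(3) pl by auto
  have hd: "l = [] \<or> isl (hd l) \<noteq> isl x"
    using Cons.prems IH pl by (cases u; cases l) (auto simp: reduced_word_def)
  have out: "x \<notin> H <+> K" using Cons.prems by (auto simp: reduced_word_def)
  have "\<exists>q t. letter_act x (p, l) = (q, t # l) \<and> isl t = isl x"
  proof (cases x)
    case (Inl a)
    have "l \<in> nA.N0" using st hd Inl by (auto simp: nA.N0_def isl_notin)
    then show ?thesis using nA.act_outside_J[of a p l] out st Inl Cons.hyps by fastforce
  next
    case (Inr b)
    have "l \<in> nB.N0" using st hd Inr by (auto simp: nB.N0_def isl_notin)
    then show ?thesis using nB.act_outside_J[of b p l] out st Inr Cons.hyps by fastforce
  qed
  then show ?case using IH pl by auto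
qed

lemma syllables_reduced: "u \<in> words \<Longrightarrow> reduced_word H K u \<Longrightarrow> syllables (cls u) = map isl u"
  using word_act_reduced[OF _ _ base_state] by (simp add: syllables_cls)

lemma syllables_H: "h \<in> H \<Longrightarrow> syllables (cls [Inl h]) = []"
  using nA.act_J[of h "\<one>\<^bsub>A\<^esub>" "[]"] by (simp add: syllables_cls)

lemma syllables_A:
  assumes "a \<in> carrier A"
  shows "syllables (cls [Inl a]) = (if a \<in> H then [] else [True])"
  using assms by (auto simp: syllables_H syllables_reduced reduced_word_def)

lemma syllables_B:
  assumes "b \<in> carrier B"
  shows "syllables (cls [Inr b]) = (if b \<in> K then [] else [False])"
proof (cases "b \<in> K")
  case True
  then obtain h where "h \<in> H" "b = \<phi> h" by (rule \<phi>_surjE)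
  then show ?thesis using cls_amalg syllables_H True by metis
next
  case False
  then show ?thesis using assms by (auto simp: syllables_reduced reduced_word_def)
qed

text \<open>The factors embed: an element that becomes trivial has no syllables, hence lies in
\<^term>\<open>H\<close>, and there the action on the amalgamated part of the normal form is multiplication.\<close>
lemma inl_eq_one:
  assumes a: "a \<in> carrier A" "cls [Inl a] = \<one>\<^bsub>G\<^esub>"
  shows "a = \<one>\<^bsub>A\<^esub>"
proof -
  have "([Inl a], []) \<in> amalg_cong A B H \<phi>"
    using a cls_eq_iff[of "[Inl a]" "[]"] by (simp add: one_cls)
  then have act: "nA.act a (\<one>\<^bsub>A\<^esub>, []) = (\<one>\<^bsub>A\<^esub>, [])"
    using word_act_cong[OF _ base_state] by fastforce
  have "syllables (cls [Inl a]) = []"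
    using act a(1) by (simp add: syllables_cls)
  then have aH: "a \<in> H" using a(1) by (simp add: syllables_A split: if_splits)
  then show ?thesis
    using act nA.act_J[OF aH, of "\<one>\<^bsub>A\<^esub>" "[]"] nA.inv_\<iota>[of a] by simp
qed

lemma inr_eq_one:
  assumes b: "b \<in> carrier B" "cls [Inr b] = \<one>\<^bsub>G\<^esub>"
  shows "b = \<one>\<^bsub>B\<^esub>"
proof -
  have "cls [Inl \<one>\<^bsub>A\<^esub>] = \<one>\<^bsub>G\<^esub>"
    unfolding one_cls by (rule cls_eqI[OF amalg_cong.one_A])
  then have "b \<in> K"
    using b syllables_B[OF b(1)] syllables_H[OF H.one_closed] by (auto split: if_splits)
  then obtain h where h: "h \<in> H" "b = \<phi> h" by (rule \<phi>_surjE)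
  then have "h = \<one>\<^bsub>A\<^esub>" using inl_eq_one[of h] b(2) cls_amalg by simp
  then show ?thesis using h(2) \<phi>_one by simp
qed

text \<open>Two letters of one side multiply to one letter; a letter from the amalgamated subgroup can be moved
to the other side first if necessary.\<close>
lemma letters_mergeable:
  assumes x: "x \<in> carrier A <+> carrier B" and y: "y \<in> carrier A <+> carrier B"
    and "isl x = isl y \<or> x \<in> H <+> K \<or> y \<in> H <+> K"
  shows "\<exists>z\<in>carrier A <+> carrier B. cls [x, y] = cls [z]"
proof -
  have same: "\<exists>z\<in>carrier A <+> carrier B. cls [x, y] = cls [z]"
    if "x \<in> carrier A <+> carrier B" "y \<in> carrier A <+> carrier B" "isl x = isl y" for x y
    using that cls_eqI[OF amalg_cong.mult_A] cls_eqI[OF amalg_cong.mult_B]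
    by (cases x; cases y) (fastforce intro: bexI[of _ "Inl _"] bexI[of _ "Inr _"])+
  have flip: "\<exists>z\<in>carrier A <+> carrier B. isl z \<noteq> isl x \<and> cls [x] = cls [z]"
    if "x \<in> H <+> K" for x
  proof (cases x)
    case (Inl h)
    then show ?thesis using that cls_amalg[of h] \<phi>_K[of h]
      by (intro bexI[of _ "Inr (\<phi> h)"]) auto
  next
    case (Inr k)
    then have "k \<in> K" using that by simp
    then obtain h where "h \<in> H" "k = \<phi> h" by (rule \<phi>_surjE)
    then show ?thesis using Inr cls_amalg[of h] by (intro bexI[of _ "Inl h"]) auto
  qed
  have mult: "cls [x, y] = cls [x] \<otimes>\<^bsub>G\<^esub> cls [y]"
    if "x \<in> carrier A <+> carrier B" "y \<in> carrier A <+> carrier B" for x y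
    using that cls_mult[of "[x]" "[y]"] by simp
  show ?thesis
  proof (cases "isl x = isl y")
    case True
    then show ?thesis using same x y by blast
  next
    case False
    then consider "x \<in> H <+> K" | "y \<in> H <+> K" using assms(3) by blast
    then show ?thesis
    proof cases
      case 1
      then obtain z where "z \<in> carrier A <+> carrier B" "isl z = isl y" "cls [x] = cls [z]"
        using flip False by blast
      then show ?thesis using same[of z y] mult[of x y] mult[of z y] x y by auto
    next
      case 2
      then obtain z where "z \<in> carrier A <+> carrier B" "isl x = isl z" "cls [y] = cls [z]"
        using flip False by blast
      then show ?thesis using same[of x z] mult[of x y] mult[of x z] x y by auto
    qed
  qed
qed

lemma not_reduced_mergeable:
  assumes "2 \<le> length u" "\<not> reduced_word H K u"
  shows "\<exists>p x y q. u = p @ [x, y] @ q \<and> (isl x = isl y \<or> x \<in> H <+> K \<or> y \<in> H <+> K)"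
  using assms
proof (induction u rule: induct_list012)
  case (3 x y u)
  show ?case
  proof (cases "isl x = isl y \<or> x \<in> H <+> K \<or> y \<in> H <+> K")
    case True
    then have "x # y # u = [] @ [x, y] @ u" by simp
    then show ?thesis using True by blast
  next
    case False
    then have red: "\<not> reduced_word H K (y # u)"
      using 3 by (auto simp: reduced_word_def)
    then have "u \<noteq> []"
      using False by (auto simp: reduced_word_def)
    then have "2 \<le> length (y # u)" by (cases u) auto
    then obtain p a b q where "y # u = p @ [a, b] @ q"
      "isl a = isl b \<or> a \<in> H <+> K \<or> b \<in> H <+> K"
      using 3 red by blast
    then have "x # y # u = (x # p) @ [a, b] @ q \<and> (isl a = isl b \<or> a \<in> H <+> K \<or> b \<in> H <+> K)"
      by simp
    then show ?thesis by blast
  qed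
qed simp_all

lemma cls_append3:
  assumes "p \<in> words" "q \<in> words" "u \<in> words" "v \<in> words" "cls u = cls v"
  shows "cls (p @ u @ q) = cls (p @ v @ q)"
proof -
  have "cls (p @ w @ q) = cls p \<otimes>\<^bsub>G\<^esub> (cls w \<otimes>\<^bsub>G\<^esub> cls q)" if "w \<in> words" for w
    using that assms(1,2) by (simp add: cls_mult)
  then show ?thesis using assms(3-5) by simp
qed

text \<open>A word with several letters that is not reduced has two mergeable neighbours.  Only nonempty words compete, so that the
identity is represented by a word with one letter instead of none.\<close>
lemma shortest_reduced:
  assumes u: "u \<in> words" "2 \<le> length u"
    and shortest: "\<And>v. v \<in> words \<Longrightarrow> v \<noteq> [] \<Longrightarrow> cls v = cls u \<Longrightarrow> length u \<le> length v"
  shows "reduced_word H K u"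
proof (rule ccontr)
  assume "\<not> reduced_word H K u"
  then obtain p x y q where uq: "u = p @ [x, y] @ q"
    and xy: "isl x = isl y \<or> x \<in> H <+> K \<or> y \<in> H <+> K"
    using not_reduced_mergeable u(2) by blast
  then obtain z where z: "z \<in> carrier A <+> carrier B" "cls [x, y] = cls [z]"
    using letters_mergeable[of x y] u(1) by auto
  have "cls (p @ [z] @ q) = cls u"
    using cls_append3[of p q "[x, y]" "[z]"] z u(1) uq by auto
  moreover have "p @ [z] @ q \<in> words" using u(1) uq z(1) by auto
  ultimately show False using shortest[of "p @ [z] @ q"] uq by auto
qed

lemma letter_reduced_or_amalgamated:
  assumes "x \<in> carrier A <+> carrier B"
  shows "reduced_word H K [x] \<or> (\<exists>h\<in>H. cls [x] = cls [Inl h])"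
proof (cases "x \<in> H <+> K")
  case False
  then show ?thesis by (simp add: reduced_word_def)
next
  case True
  then show ?thesis
  proof (cases x)
    case (Inr k)
    then show ?thesis using True cls_amalg by (auto elim: \<phi>_surjE)
  qed auto
qed

lemma nonempty_wordE:
  assumes "g \<in> carrier G"
  obtains u where "u \<in> words" "u \<noteq> []" "cls u = g"
proof -
  obtain u where u: "u \<in> words" "g = cls u" using assms by (rule carrierE)
  show thesis
  proof (cases "u = []")
    case True
    then show ?thesis using that[of "[Inl \<one>\<^bsub>A\<^esub>]"] u cls_eqI[OF amalg_cong.one_A] by simp
  next
    case False
    then show ?thesis using that[of u] u by simp
  qed
qed

lemma reduced_form:
  assumes "g \<in> carrier G"
  shows "(\<exists>u\<in>words. reduced_word H K u \<and> g = cls u) \<or> (\<exists>h\<in>H. g = cls [Inl h])"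
proof -
  define u where "u = arg_min length (\<lambda>v. v \<in> words \<and> v \<noteq> [] \<and> cls v = g)"
  have "\<exists>v. v \<in> words \<and> v \<noteq> [] \<and> cls v = g"
    using nonempty_wordE[OF assms] by blast
  then have u: "u \<in> words" "u \<noteq> []" "cls u = g"
    and shortest: "\<And>v. v \<in> words \<Longrightarrow> v \<noteq> [] \<Longrightarrow> cls v = g \<Longrightarrow> length u \<le> length v"
    using arg_min_nat_lemma[of "\<lambda>v. v \<in> words \<and> v \<noteq> [] \<and> cls v = g" _ length]
    unfolding u_def by blast+
  show ?thesis
  proof (cases "2 \<le> length u")
    case True
    then show ?thesis using shortest_reduced u shortest by blast
  next
    case False
    then obtain x where "u = [x]" using u(2) by (cases u; cases "tl u") auto
    then show ?thesis using letter_reduced_or_amalgamated[of x] u by auto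
  qed
qed

definition cyclically_reduced :: "('a + 'b) list \<Rightarrow> bool" where
  "cyclically_reduced u \<longleftrightarrow> reduced_word H K u \<and> isl (hd u) \<noteq> isl (last u)"

text \<open>Take the shortest nonempty word that represents a conjugate.  If it has more than one letter it is
reduced, and its end letters lie on different sides, since otherwise conjugation would bring them
together and merge them.\<close>
lemma conjugate_normal_form:
  assumes c: "c \<in> carrier G"
  shows "\<exists>u\<in>words. \<exists>g\<in>carrier G. cls u = g \<otimes>\<^bsub>G\<^esub> c \<otimes>\<^bsub>G\<^esub> inv\<^bsub>G\<^esub> g \<and>
    (cyclically_reduced u \<and> u \<noteq> [] \<or> (\<exists>x\<in>carrier A <+> carrier B. u = [x]))"
proof -
  define conj where "conj v \<longleftrightarrow> v \<in> words \<and> v \<noteq> [] \<and>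
    (\<exists>g\<in>carrier G. cls v = g \<otimes>\<^bsub>G\<^esub> c \<otimes>\<^bsub>G\<^esub> inv\<^bsub>G\<^esub> g)" for v
  have "\<exists>v. v \<in> words \<and> v \<noteq> [] \<and> cls v = c"
    using nonempty_wordE[OF c] by blast
  then have "\<exists>v. conj v"
    using c unfolding conj_def by (auto intro!: bexI[of _ "\<one>\<^bsub>G\<^esub>"])
  then obtain u where u: "conj u" and shortest: "\<And>v. conj v \<Longrightarrow> length u \<le> length v"
    using arg_min_nat_lemma[of conj _ length] by blast
  obtain g where g: "g \<in> carrier G" "cls u = g \<otimes>\<^bsub>G\<^esub> c \<otimes>\<^bsub>G\<^esub> inv\<^bsub>G\<^esub> g"
    using u conj_def by blast
  have uW: "u \<in> words" "u \<noteq> []" using u conj_def by auto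
  show ?thesis
  proof (cases "2 \<le> length u")
    case False
    then obtain x where "u = [x]" using uW(2) by (cases u; cases "tl u") auto
    moreover from this have "x \<in> carrier A <+> carrier B" using uW(1) by simp
    ultimately show ?thesis using g uW(1) by blast
  next
    case True
    have red: "reduced_word H K u"
    proof (rule shortest_reduced[OF uW(1) True])
      fix v assume "v \<in> words" "v \<noteq> []" "cls v = cls u"
      then have "conj v" using g unfolding conj_def by auto
      then show "length u \<le> length v" by (rule shortest)
    qed
    obtain x m y where xy: "u = x # m @ [y]"
      using True by (cases u; cases "tl u" rule: rev_cases) auto
    have W: "x \<in> carrier A <+> carrier B" "y \<in> carrier A <+> carrier B" "m \<in> words"
      using uW(1) xy by auto
    have "isl x \<noteq> isl y"
    proof
      assume "isl x = isl y"
      then obtain z where z: "z \<in> carrier A <+> carrier B" "cls [y, x] = cls [z]"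
        using letters_mergeable[of y x] W by auto
      have Y: "cls [y] \<in> carrier G" "cls (x # m) \<in> carrier G"
        using W by (auto intro!: cls_carrier)
      have "cls (z # m) = cls ([y] @ x # m)"
        using cls_append3[of "[]" m "[y, x]" "[z]"] z W by simp
      also have "\<dots> = cls [y] \<otimes>\<^bsub>G\<^esub> cls (x # m)"
        using cls_mult[of "[y]" "x # m"] W by simp
      also have "\<dots> = cls [y] \<otimes>\<^bsub>G\<^esub> (cls (x # m) \<otimes>\<^bsub>G\<^esub> cls [y]) \<otimes>\<^bsub>G\<^esub> inv\<^bsub>G\<^esub> (cls [y])"
        using Y by (simp add: G.m_assoc)
      also have "cls (x # m) \<otimes>\<^bsub>G\<^esub> cls [y] = cls u"
        using cls_mult[of "x # m" "[y]"] W xy by simp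
      also have "cls [y] \<otimes>\<^bsub>G\<^esub> cls u \<otimes>\<^bsub>G\<^esub> inv\<^bsub>G\<^esub> (cls [y]) =
          (cls [y] \<otimes>\<^bsub>G\<^esub> g) \<otimes>\<^bsub>G\<^esub> c \<otimes>\<^bsub>G\<^esub> inv\<^bsub>G\<^esub> (cls [y] \<otimes>\<^bsub>G\<^esub> g)"
        using Y g c by (simp add: G.m_assoc G.inv_mult_group)
      finally have "conj (z # m)"
        unfolding conj_def using z(1) W Y(1) g(1) by auto
      then show False using shortest[of "z # m"] xy by simp
    qed
    then have "cyclically_reduced u" using red xy by (simp add: cyclically_reduced_def)
    then show ?thesis using g uW by blast
  qed
qed

text \<open>No letters meet at the seams between the copies of a cyclically reduced word, so its powers are
again reduced.\<close>
lemma cyclically_reduced_power: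
  assumes u: "u \<in> words" "cyclically_reduced u" "u \<noteq> []"
  shows "reduced_word H K (concat (replicate n u))"
    and "concat (replicate n u) \<in> words"
    and "cls (concat (replicate n u)) = cls u [^]\<^bsub>G\<^esub> n"
proof -
  show W: "concat (replicate n u) \<in> words" for n
    using u(1) by (induction n) auto
  show "cls (concat (replicate n u)) = cls u [^]\<^bsub>G\<^esub> n"
  proof (induction n)
    case (Suc n)
    then show ?case
      using cls_mult[OF u(1) W[of n]] G.nat_pow_Suc2[OF cls_carrier[OF u(1)], of n] by simp
  qed (simp add: one_cls)
  show "reduced_word H K (concat (replicate n u))"
  proof (induction n)
    case (Suc n)
    show ?case
    proof (cases n)
      case 0
      then show ?thesis using u by (simp add: cyclically_reduced_def)
    next
      case (Suc k)
      then show ?thesis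
        using Suc.IH u
        by (auto simp: cyclically_reduced_def reduced_word_def distinct_adj_append_iff hd_map last_map)
    qed
  qed (simp add: reduced_word_def)
qed

lemma syllables_power:
  assumes "u \<in> words" "cyclically_reduced u" "u \<noteq> []"
  shows "length (syllables (cls u [^]\<^bsub>G\<^esub> n)) = n * length u"
proof -
  have "syllables (cls (concat (replicate n u))) = map isl (concat (replicate n u))"
    by (intro syllables_reduced cyclically_reduced_power assms)
  then show ?thesis
    by (simp add: cyclically_reduced_power(3)[OF assms] length_concat sum_list_replicate)
qed

end

section \<open>Finite permutation representations of amalgams of finite groups\<close>

locale free_set_action = set_action +
  assumes act_free: "x \<in> carrier X \<Longrightarrow> y \<in> Y \<Longrightarrow> f x y = y \<Longrightarrow> x = \<one>"
begin

lemma act_inj: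
  assumes "x \<in> carrier X" "x' \<in> carrier X" "y \<in> Y" "f x y = f x' y"
  shows "x = x'"
proof -
  have "f (inv x' \<otimes> x) y = y"
    using assms by (simp add: act_mult act_inv)
  then have "inv x' \<otimes> x = \<one>"
    using assms by (intro act_free) auto
  then show ?thesis
    using assms by (metis inv_closed inv_equality inv_inv)
qed

text \<open>A free action has coordinates: every point is \<open>f (coord y) (orbit_rep y)\<close> for exactly one group
element \<open>coord y\<close>.\<close>
definition orbit_rep where
  "orbit_rep y = (SOME w. w \<in> (\<lambda>x. f x y) ` carrier X)"

definition coord where
  "coord y = (SOME x. x \<in> carrier X \<and> f x (orbit_rep y) = y)"

lemma orbit_rep_act:
  assumes "x \<in> carrier X" "y \<in> Y"
  shows "orbit_rep (f x y) = orbit_rep y"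
proof -
  have "(\<lambda>x'. f x' (f x y)) ` carrier X = (\<lambda>x'. f x' y) ` carrier X" (is "?L = ?R")
  proof
    show "?L \<subseteq> ?R" using assms by (auto simp: act_mult[symmetric])
    show "?R \<subseteq> ?L"
    proof
      fix w assume "w \<in> ?R"
      then obtain x' where x': "x' \<in> carrier X" "w = f x' y" by blast
      then have "w = f (x' \<otimes> inv x) (f x y)" using assms by (simp add: act_mult act_inv act_closed)
      then show "w \<in> ?L" using assms x' by blast
    qed
  qed
  then show ?thesis by (simp add: orbit_rep_def)
qed

lemma orbit_rep_coord:
  assumes "y \<in> Y"
  shows orbit_rep_closed: "orbit_rep y \<in> Y"
    and coord_closed: "coord y \<in> carrier X"
    and act_coord: "f (coord y) (orbit_rep y) = y"
proof -
  have "f \<one> y \<in> (\<lambda>x. f x y) ` carrier X" by blast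
  then have "orbit_rep y \<in> (\<lambda>x. f x y) ` carrier X"
    unfolding orbit_rep_def by (rule someI)
  then obtain x where x: "x \<in> carrier X" "orbit_rep y = f x y" by blast
  then show "orbit_rep y \<in> Y" using assms act_closed by simp
  have "inv x \<in> carrier X \<and> f (inv x) (orbit_rep y) = y"
    using x assms by (simp add: act_inv)
  then have "coord y \<in> carrier X \<and> f (coord y) (orbit_rep y) = y"
    unfolding coord_def by (rule someI)
  then show "coord y \<in> carrier X" "f (coord y) (orbit_rep y) = y" by auto
qed

lemma orbit_rep_idem: "y \<in> Y \<Longrightarrow> orbit_rep (orbit_rep y) = orbit_rep y"
  by (metis act_coord coord_closed orbit_rep_act orbit_rep_closed)

lemma coord_act_rep:
  assumes "x \<in> carrier X" "y \<in> Y"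
  shows "coord (f x (orbit_rep y)) = x"
proof (rule act_inj)
  have y': "f x (orbit_rep y) \<in> Y" using assms by (simp add: act_closed orbit_rep_closed)
  show "coord (f x (orbit_rep y)) \<in> carrier X" by (rule coord_closed[OF y'])
  show "f (coord (f x (orbit_rep y))) (orbit_rep y) = f x (orbit_rep y)"
    using act_coord[OF y'] assms by (simp add: orbit_rep_act orbit_rep_closed orbit_rep_idem)
qed (use assms in \<open>auto simp: orbit_rep_closed\<close>)

lemma coord_act:
  assumes "x \<in> carrier X" "y \<in> Y"
  shows "coord (f x y) = x \<otimes> coord y"
proof -
  have "f x y = f (x \<otimes> coord y) (orbit_rep y)"
    using assms by (simp add: act_mult act_coord coord_closed orbit_rep_closed)
  then show ?thesis using coord_act_rep[of "x \<otimes> coord y" y] assms by (simp add: coord_closed)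
qed

end

text \<open>Acting on the first or on the second factor of \<open>U \<times> V\<close> gives isomorphic sets.  In coordinates
points of the two orbits are \<open>(p o, q o')\<close>, and \<open>\<theta>\<close> exchanges \<open>p\<close> and \<open>q\<close>.  This
replaces a comparison of numbers of orbits.\<close>
lemma free_actions_swap:
  assumes "free_set_action P U f" and "free_set_action P V k"
  shows "\<exists>\<theta>. (\<forall>z\<in>U \<times> V. \<theta> z \<in> U \<times> V \<and> \<theta> (\<theta> z) = z) \<and>
    (\<forall>p\<in>carrier P. \<forall>u\<in>U. \<forall>v\<in>V. \<theta> (f p u, v) = apsnd (k p) (\<theta> (u, v)))"
proof -
  interpret U: free_set_action P U f by fact
  interpret V: free_set_action P V k by fact
  define \<theta> where "\<theta> = (\<lambda>(u, v). (f (V.coord v) (U.orbit_rep u), k (U.coord u) (V.orbit_rep v)))"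
  show ?thesis
  proof (intro exI[of _ \<theta>] conjI ballI)
    show "\<theta> z \<in> U \<times> V" if "z \<in> U \<times> V" for z
      using that by (auto simp: \<theta>_def U.act_closed V.act_closed U.orbit_rep_coord V.orbit_rep_coord)
    show "\<theta> (\<theta> z) = z" if "z \<in> U \<times> V" for z
      using that by (auto simp: \<theta>_def U.orbit_rep_coord V.orbit_rep_coord U.coord_act_rep
          V.coord_act_rep U.orbit_rep_act V.orbit_rep_act U.orbit_rep_idem V.orbit_rep_idem)
    show "\<theta> (f p u, v) = apsnd (k p) (\<theta> (u, v))" if "p \<in> carrier P" "u \<in> U" "v \<in> V" for p u v
      using that by (simp add: \<theta>_def U.orbit_rep_act U.coord_act V.act_mult U.orbit_rep_coord V.orbit_rep_coord)
  qed
qed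

context amalgam
begin

text \<open>Enlarge the given points to a finite \<^term>\<open>A\<close>-invariant set \<open>T\<close> that contains their
\<^term>\<open>B\<close>-orbits.  The \<^term>\<open>B\<close>-action is defined on the part \<open>TB\<close> of \<open>T\<close> formed by the
\<^term>\<open>B\<close>-orbits inside \<open>T\<close>; on the rest \<open>U\<close> only the amalgamated subgroup acts, and a
\<^term>\<open>B\<close>-action extending this need not exist, as the number of orbits may be wrong.  It does
exist on \<open>U \<times> B\<close>: the swap \<open>\<theta>\<close> turns the action of \<^term>\<open>H\<close> on the first factor into its action
on the second, and that extends to left multiplication by \<^term>\<open>B\<close>.  So \<open>T \<times> B\<close> is a finite set on
which both factors act compatibly, and along \<open>T \<times> {1}\<close> nothing has changed at the given points.\<close>

lemma finite_extension:
  fixes Y :: "'y set"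
  assumes fin: "finite (carrier A)" "finite (carrier B)"
    and fA: "free_set_action A Y fA" and fB: "free_set_action B Y fB"
    and agree: "\<And>h y. h \<in> H \<Longrightarrow> y \<in> Y \<Longrightarrow> fA h y = fB (\<phi> h) y"
    and D: "finite D" "D \<subseteq> Y"
  shows "\<exists>(X :: ('y \<times> 'b) set) \<psi>. finite X \<and> \<psi> \<in> hom G (BijGroup X) \<and>
    (\<forall>y\<in>D. (y, \<one>\<^bsub>B\<^esub>) \<in> X \<and>
      (\<forall>a\<in>carrier A. \<psi> (cls [Inl a]) (y, \<one>\<^bsub>B\<^esub>) = (fA a y, \<one>\<^bsub>B\<^esub>)) \<and>
      (\<forall>b\<in>carrier B. \<psi> (cls [Inr b]) (y, \<one>\<^bsub>B\<^esub>) = (fB b y, \<one>\<^bsub>B\<^esub>)))"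
proof -
  interpret fA: free_set_action A Y fA by fact
  interpret fB: free_set_action B Y fB by fact
  define T where "T = (\<lambda>(a, b, y). fA a (fB b y)) ` (carrier A \<times> carrier B \<times> D)"
  define TB where "TB = {t \<in> T. \<forall>b\<in>carrier B. fB b t \<in> T}"
  define U where "U = T - TB"
  have finT: "finite T" using fin D by (simp add: T_def)
  have TY: "T \<subseteq> Y" using D by (auto simp: T_def fA.act_closed fB.act_closed)
  have T_A: "fA a t \<in> T" if "a \<in> carrier A" and tT: "t \<in> T" for a t
  proof -
    obtain a' b y where t: "a' \<in> carrier A" "b \<in> carrier B" "y \<in> D" "t = fA a' (fB b y)"
      using tT by (auto simp: T_def)
    have "fA a t = fA (a \<otimes>\<^bsub>A\<^esub> a') (fB b y)"
      using t that(1) D by (auto simp: fA.act_mult fB.act_closed)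
    then show ?thesis
      unfolding T_def using t that(1) by (intro image_eqI[of _ _ "(a \<otimes>\<^bsub>A\<^esub> a', b, y)"]) auto
  qed
  have D_T: "fB b y \<in> T" if "b \<in> carrier B" "y \<in> D" for b y
    unfolding T_def using that D
    by (intro image_eqI[of _ _ "(\<one>\<^bsub>A\<^esub>, b, y)"]) (auto simp: fA.act_one fB.act_closed)
  have D_TB: "D \<subseteq> TB"
  proof
    fix y assume y: "y \<in> D"
    then have "fB \<one>\<^bsub>B\<^esub> y = y" using D by (auto intro: fB.act_one)
    then have "y \<in> T" using D_T[OF B.one_closed y] by simp
    then show "y \<in> TB" using D_T y by (simp add: TB_def)
  qed
  have TB_B: "fB b t \<in> TB" if "b \<in> carrier B" "t \<in> TB" for b t
    using that TY by (auto simp: TB_def fB.act_mult[symmetric] subset_iff)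
  have HB: "\<phi> h \<in> carrier B" if "h \<in> H" for h using \<phi>_K[OF that] by (rule K.mem_carrier)
  have U_H: "fA h u \<in> U" if "h \<in> H" "u \<in> U" for h u
  proof -
    have u: "u \<in> T" "u \<notin> TB" "u \<in> Y" using that TY by (auto simp: U_def)
    have undo: "fB (inv\<^bsub>B\<^esub> (\<phi> h)) (fA h u) = u"
      using that u HB by (simp add: agree fB.act_inv)
    have "fA h u \<notin> TB"
    proof
      assume "fA h u \<in> TB"
      from TB_B[OF _ this, of "inv\<^bsub>B\<^esub> (\<phi> h)"] show False using undo u HB[OF that(1)] by simp
    qed
    then show ?thesis using T_A that u by (auto simp: U_def)
  qed
  interpret P: group "A\<lparr>carrier := H\<rparr>" by (rule group_H)
  have actU: "free_set_action (A\<lparr>carrier := H\<rparr>) U fA"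
  proof
    show "fA x y \<in> U" if "x \<in> carrier (A\<lparr>carrier := H\<rparr>)" "y \<in> U" for x y
      using that U_H by simp
    show "fA \<one>\<^bsub>A\<lparr>carrier := H\<rparr>\<^esub> y = y" if "y \<in> U" for y
      using that TY fA.act_one by (auto simp: U_def)
    show "fA (x \<otimes>\<^bsub>A\<lparr>carrier := H\<rparr>\<^esub> x') y = fA x (fA x' y)"
      if "x \<in> carrier (A\<lparr>carrier := H\<rparr>)" "x' \<in> carrier (A\<lparr>carrier := H\<rparr>)" "y \<in> U" for x x' y
      using that TY fA.act_mult[of x x' y] by (auto simp: U_def)
    show "x = \<one>\<^bsub>A\<lparr>carrier := H\<rparr>\<^esub>"
      if "x \<in> carrier (A\<lparr>carrier := H\<rparr>)" "y \<in> U" "fA x y = y" for x y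
      using that TY fA.act_free[of x y] by (auto simp: U_def)
  qed
  have actV: "free_set_action (A\<lparr>carrier := H\<rparr>) (carrier B) (\<lambda>h v. \<phi> h \<otimes>\<^bsub>B\<^esub> v)"
  proof
    show "\<phi> x \<otimes>\<^bsub>B\<^esub> y \<in> carrier B" if "x \<in> carrier (A\<lparr>carrier := H\<rparr>)" "y \<in> carrier B" for x y
      using that HB by simp
    show "\<phi> \<one>\<^bsub>A\<lparr>carrier := H\<rparr>\<^esub> \<otimes>\<^bsub>B\<^esub> y = y" if "y \<in> carrier B" for y
      using that by (simp add: \<phi>_one)
    show "\<phi> (x \<otimes>\<^bsub>A\<lparr>carrier := H\<rparr>\<^esub> x') \<otimes>\<^bsub>B\<^esub> y = \<phi> x \<otimes>\<^bsub>B\<^esub> (\<phi> x' \<otimes>\<^bsub>B\<^esub> y)"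
      if "x \<in> carrier (A\<lparr>carrier := H\<rparr>)" "x' \<in> carrier (A\<lparr>carrier := H\<rparr>)" "y \<in> carrier B" for x x' y
      using that HB by (simp add: \<phi>_mult B.m_assoc)
    show "x = \<one>\<^bsub>A\<lparr>carrier := H\<rparr>\<^esub>"
      if "x \<in> carrier (A\<lparr>carrier := H\<rparr>)" "y \<in> carrier B" "\<phi> x \<otimes>\<^bsub>B\<^esub> y = y" for x y
    proof -
      have "\<phi> x = \<phi> \<one>\<^bsub>A\<^esub>" using that HB[of x] by (simp add: \<phi>_one B.r_cancel_one)
      then show ?thesis using that(1) \<phi>_bij by (auto simp: bij_betw_def inj_on_def)
    qed
  qed
  obtain \<theta> where \<theta>_inv: "\<forall>z\<in>U \<times> carrier B. \<theta> z \<in> U \<times> carrier B \<and> \<theta> (\<theta> z) = z"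
    and \<theta>_P: "\<forall>h\<in>carrier (A\<lparr>carrier := H\<rparr>). \<forall>u\<in>U. \<forall>v\<in>carrier B.
      \<theta> (fA h u, v) = apsnd (\<lambda>v. \<phi> h \<otimes>\<^bsub>B\<^esub> v) (\<theta> (u, v))"
    using free_actions_swap[OF actU actV] by blast
  have \<theta>: "\<theta> z \<in> U \<times> carrier B" "\<theta> (\<theta> z) = z" if "z \<in> U \<times> carrier B" for z
    using \<theta>_inv that by blast+
  have \<theta>_H: "\<theta> (fA h u, v) = apsnd (\<lambda>v. \<phi> h \<otimes>\<^bsub>B\<^esub> v) (\<theta> (u, v))"
    if "h \<in> H" "u \<in> U" "v \<in> carrier B" for h u v
    using \<theta>_P that by simp
  have \<theta>_inj: "z = z'" if "z \<in> U \<times> carrier B" "z' \<in> U \<times> carrier B" "\<theta> z = \<theta> z'" for z z'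
    using arg_cong[OF that(3), of \<theta>] unfolding \<theta>(2)[OF that(1)] \<theta>(2)[OF that(2)] .
  define X where "X = T \<times> carrier B"
  define gA :: "'a \<Rightarrow> 'y \<times> 'b \<Rightarrow> 'y \<times> 'b" where "gA a = apfst (fA a)" for a
  \<comment> \<open>On \<open>U \<times> carrier B\<close> the action of \<^term>\<open>B\<close> is left multiplication, conjugated by \<open>\<theta>\<close>.\<close>
  define gB where "gB b z = (if fst z \<in> TB then apfst (fB b) z
      else \<theta> (apsnd (\<lambda>v. b \<otimes>\<^bsub>B\<^esub> v) (\<theta> z)))" for b z
  have X_cases: "z \<in> X \<Longrightarrow> z \<in> U \<times> carrier B \<or> z \<in> TB \<times> carrier B" for z
    by (auto simp: X_def U_def)
  have sub: "U \<times> carrier B \<subseteq> X" "TB \<times> carrier B \<subseteq> X"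
    by (auto simp: X_def U_def TB_def)
  have gB_U: "gB b z \<in> U \<times> carrier B" "\<theta> (gB b z) = apsnd (\<lambda>v. b \<otimes>\<^bsub>B\<^esub> v) (\<theta> z)"
    if "z \<in> U \<times> carrier B" "b \<in> carrier B" for b z
  proof -
    have w: "apsnd (\<lambda>v. b \<otimes>\<^bsub>B\<^esub> v) (\<theta> z) \<in> U \<times> carrier B"
      using \<theta>(1)[OF that(1)] that(2) by auto
    have "fst z \<notin> TB" using that(1) by (auto simp: U_def)
    then have eq: "gB b z = \<theta> (apsnd (\<lambda>v. b \<otimes>\<^bsub>B\<^esub> v) (\<theta> z))" by (simp add: gB_def)
    show "gB b z \<in> U \<times> carrier B" "\<theta> (gB b z) = apsnd (\<lambda>v. b \<otimes>\<^bsub>B\<^esub> v) (\<theta> z)"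
      unfolding eq by (rule \<theta>[OF w])+
  qed
  have gB_TB: "gB b z = (fB b (fst z), snd z)" if "z \<in> TB \<times> carrier B" for b z
    using that by (auto simp: gB_def)
  have TB_Y: "TB \<subseteq> Y" using TY by (auto simp: TB_def)
  have gA_act: "set_action A X gA"
    using T_A TY by unfold_locales (auto simp: gA_def X_def fA.act_one fA.act_mult subset_iff)
  have gB_act: "set_action B X gB"
  proof
    fix x z assume x: "x \<in> carrier B" and z: "z \<in> X"
    show "gB x z \<in> X"
      using X_cases[OF z] gB_U(1)[OF _ x] gB_TB TB_B[OF x] sub by (auto simp del: mem_Sigma_iff) auto
  next
    fix z assume z: "z \<in> X"
    show "gB \<one>\<^bsub>B\<^esub> z = z"
    proof (cases "z \<in> U \<times> carrier B")
      case True
      obtain u v where "\<theta> z = (u, v)" "v \<in> carrier B" using \<theta>(1)[OF True] by auto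
      then have "\<theta> (gB \<one>\<^bsub>B\<^esub> z) = \<theta> z" using gB_U(2)[OF True B.one_closed] by simp
      then show ?thesis using \<theta>_inj[OF gB_U(1)[OF True B.one_closed] True] by simp
    next
      case False
      then show ?thesis using X_cases[OF z] gB_TB[of z] TB_Y by (auto simp: fB.act_one)
    qed
  next
    fix x x' z assume x: "x \<in> carrier B" "x' \<in> carrier B" and z: "z \<in> X"
    show "gB (x \<otimes>\<^bsub>B\<^esub> x') z = gB x (gB x' z)"
    proof (cases "z \<in> U \<times> carrier B")
      case True
      obtain u v where uv: "\<theta> z = (u, v)" "v \<in> carrier B" using \<theta>(1)[OF True] by auto
      have z': "gB x' z \<in> U \<times> carrier B" by (rule gB_U(1)[OF True x(2)])
      have "\<theta> (gB (x \<otimes>\<^bsub>B\<^esub> x') z) = \<theta> (gB x (gB x' z))"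
        using gB_U(2)[OF True, of "x \<otimes>\<^bsub>B\<^esub> x'"] gB_U(2)[OF True x(2)] gB_U(2)[OF z' x(1)] x uv
        by (simp add: B.m_assoc)
      then show ?thesis
        using \<theta>_inj[OF gB_U(1)[OF True, of "x \<otimes>\<^bsub>B\<^esub> x'"] gB_U(1)[OF z' x(1)]] x by simp
    next
      case False
      then have "z \<in> TB \<times> carrier B" using X_cases[OF z] by blast
      then show ?thesis
        using gB_TB x TB_B TB_Y by (auto simp: fB.act_mult subset_iff)
    qed
  qed
  have gAB: "gA h z = gB (\<phi> h) z" if h: "h \<in> H" and z: "z \<in> X" for h z
  proof (cases "z \<in> U \<times> carrier B")
    case True
    then obtain u v where uv: "z = (u, v)" "u \<in> U" "v \<in> carrier B" by blast
    have gA: "gA h z = (fA h u, v)" by (simp add: gA_def uv(1))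
    have eq: "\<theta> (gA h z) = \<theta> (gB (\<phi> h) z)"
      using \<theta>_H[OF h uv(2,3)] gB_U(2)[OF True HB[OF h]] gA uv(1) by metis
    have mem: "gA h z \<in> U \<times> carrier B" using uv U_H[OF h] by (simp add: gA_def)
    show ?thesis by (rule \<theta>_inj[OF mem gB_U(1)[OF True HB[OF h]] eq])
  next
    case False
    then have zTB: "z \<in> TB \<times> carrier B" using X_cases[OF z] by blast
    then have "fst z \<in> Y" using TB_Y by auto
    then show ?thesis unfolding gB_TB[OF zTB] gA_def using agree[OF h] by (simp add: prod_eq_iff)
  qed
  have "\<exists>\<psi>\<in>hom G (BijGroup X).
      (\<forall>a\<in>carrier A. \<psi> (amalg_inl A B H \<phi> a) = restrict (gA a) X) \<and>
      (\<forall>b\<in>carrier B. \<psi> (amalg_inr A B H \<phi> b) = restrict (gB b) X)"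
  proof (rule amalg_product_lift[OF amalgam_data group_BijGroup])
    show "(\<lambda>a. restrict (gA a) X) \<in> hom A (BijGroup X)"
      by (rule set_action.restrict_act_hom[OF gA_act])
    show "(\<lambda>b. restrict (gB b) X) \<in> hom B (BijGroup X)"
      by (rule set_action.restrict_act_hom[OF gB_act])
    show "restrict (gA h) X = restrict (gB (\<phi> h)) X" if "h \<in> H" for h
      using gAB[OF that] by (rule restrict_ext)
  qed
  then obtain \<psi> where \<psi>: "\<psi> \<in> hom G (BijGroup X)"
      "\<And>a. a \<in> carrier A \<Longrightarrow> \<psi> (cls [Inl a]) = restrict (gA a) X"
      "\<And>b. b \<in> carrier B \<Longrightarrow> \<psi> (cls [Inr b]) = restrict (gB b) X"
    by (auto simp: amalg_inl_def amalg_inr_def)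
  have finX: "finite X" using finT fin by (simp add: X_def)
  have e: "(y, \<one>\<^bsub>B\<^esub>) \<in> TB \<times> carrier B" if "y \<in> D" for y using that D_TB by auto
  show ?thesis
  proof (intro exI[of _ X] exI[of _ \<psi>] conjI ballI)
    fix y assume y: "y \<in> D"
    show yX: "(y, \<one>\<^bsub>B\<^esub>) \<in> X" using e[OF y] sub by blast
    show "\<psi> (cls [Inl a]) (y, \<one>\<^bsub>B\<^esub>) = (fA a y, \<one>\<^bsub>B\<^esub>)" if "a \<in> carrier A" for a
      using \<psi>(2)[OF that] yX by (simp add: gA_def)
    show "\<psi> (cls [Inr b]) (y, \<one>\<^bsub>B\<^esub>) = (fB b y, \<one>\<^bsub>B\<^esub>)" if "b \<in> carrier B" for b
      using \<psi>(3)[OF that] yX gB_TB[OF e[OF y]] by simp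
  qed (use finX \<psi>(1) in auto)
qed

text \<open>If every suffix of a word leads to a point where the finite permutation representation imitates
the action on cosets, then so does the whole word.\<close>
lemma word_in_finite_extension:
  assumes \<psi>: "\<psi> \<in> hom G (BijGroup X)" and N: "subgroup N G" and u: "u \<in> words"
    and D: "\<And>y. y \<in> D \<Longrightarrow> (y, \<one>\<^bsub>B\<^esub>) \<in> X \<and>
      (\<forall>a\<in>carrier A. \<psi> (cls [Inl a]) (y, \<one>\<^bsub>B\<^esub>) = (cls [Inl a] <#\<^bsub>G\<^esub> y, \<one>\<^bsub>B\<^esub>)) \<and>
      (\<forall>b\<in>carrier B. \<psi> (cls [Inr b]) (y, \<one>\<^bsub>B\<^esub>) = (cls [Inr b] <#\<^bsub>G\<^esub> y, \<one>\<^bsub>B\<^esub>))"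
    and suffixes: "\<And>i. i \<le> length u \<Longrightarrow> cls (drop i u) <#\<^bsub>G\<^esub> N \<in> D"
  shows "\<psi> (cls u) (N, \<one>\<^bsub>B\<^esub>) = (cls u <#\<^bsub>G\<^esub> N, \<one>\<^bsub>B\<^esub>)"
proof -
  have NG: "N \<subseteq> carrier G" by (rule subgroup.subset[OF N])
  have one: "cls [] <#\<^bsub>G\<^esub> N = N" using G.lcos_mult_one[OF NG] by (simp add: one_cls)
  have base: "(N, \<one>\<^bsub>B\<^esub>) \<in> X" using suffixes[of "length u"] D one by simp
  show ?thesis
    using u suffixes
  proof (induction u)
    case Nil
    have "\<psi> (cls []) = \<one>\<^bsub>BijGroup X\<^esub>"
      using hom_one[OF \<psi> G.group_axioms group_BijGroup] by (simp add: one_cls)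
    then show ?case using base one by (simp add: BijGroup_def)
  next
    case (Cons x u)
    have W: "[x] \<in> words" "u \<in> words" using Cons.hyps by auto
    have "cls (drop i u) <#\<^bsub>G\<^esub> N \<in> D" if "i \<le> length u" for i
      using Cons.prems[of "Suc i"] that by simp
    note IH = Cons.IH[OF this] and Du = this[of 0, simplified]
    have "cls (x # u) = cls [x] \<otimes>\<^bsub>G\<^esub> cls u" using cls_mult[OF W] by simp
    then have "\<psi> (cls (x # u)) = compose X (\<psi> (cls [x])) (\<psi> (cls u))"
      using hom_mult[OF \<psi> cls_carrier[OF W(1)] cls_carrier[OF W(2)]]
        hom_in_carrier[OF \<psi> cls_carrier[OF W(1)]] hom_in_carrier[OF \<psi> cls_carrier[OF W(2)]]
      by (simp add: BijGroup_def)
    then have "\<psi> (cls (x # u)) (N, \<one>\<^bsub>B\<^esub>) = \<psi> (cls [x]) (cls u <#\<^bsub>G\<^esub> N, \<one>\<^bsub>B\<^esub>)"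
      using base IH by (simp add: compose_def)
    also have "\<dots> = (cls [x] <#\<^bsub>G\<^esub> (cls u <#\<^bsub>G\<^esub> N), \<one>\<^bsub>B\<^esub>)"
      using D[OF Du] Cons.hyps(1) by (cases x) auto
    also have "cls [x] <#\<^bsub>G\<^esub> (cls u <#\<^bsub>G\<^esub> N) = cls (x # u) <#\<^bsub>G\<^esub> N"
      using G.lcos_m_assoc[OF NG cls_carrier[OF W(1)] cls_carrier[OF W(2)]] cls_mult[OF W] by simp
    finally show ?case .
  qed
qed

lemma coset_self: "subgroup N G \<Longrightarrow> g \<in> carrier G \<Longrightarrow> g \<in> g <#\<^bsub>G\<^esub> N"
  by (auto simp: l_coset_def intro!: bexI[of _ "\<one>\<^bsub>G\<^esub>"] subgroup.one_closed)

lemma coset_action: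
  assumes N: "subgroup N G" and i: "i \<in> hom X G" and X: "group X"
    and free: "\<And>x g. x \<in> carrier X \<Longrightarrow> g \<in> carrier G \<Longrightarrow>
      inv\<^bsub>G\<^esub> g \<otimes>\<^bsub>G\<^esub> i x \<otimes>\<^bsub>G\<^esub> g \<in> N \<Longrightarrow> x = \<one>\<^bsub>X\<^esub>"
  shows "free_set_action X ((\<lambda>g. g <#\<^bsub>G\<^esub> N) ` carrier G) (\<lambda>x y. i x <#\<^bsub>G\<^esub> y)"
proof -
  interpret X: group X by fact
  have NG: "N \<subseteq> carrier G" by (rule subgroup.subset[OF N])
  have ic: "i x \<in> carrier G" if "x \<in> carrier X" for x using hom_in_carrier[OF i that] .
  show ?thesis
  proof
    show "i x <#\<^bsub>G\<^esub> y \<in> (\<lambda>g. g <#\<^bsub>G\<^esub> N) ` carrier G"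
      if "x \<in> carrier X" "y \<in> (\<lambda>g. g <#\<^bsub>G\<^esub> N) ` carrier G" for x y
      using that ic NG by (auto simp: G.lcos_m_assoc)
    show "i \<one>\<^bsub>X\<^esub> <#\<^bsub>G\<^esub> y = y" if "y \<in> (\<lambda>g. g <#\<^bsub>G\<^esub> N) ` carrier G" for y
      using that NG hom_one[OF i X G.group_axioms]
      by (auto intro!: G.lcos_mult_one dest: G.l_coset_subset_G)
    show "i (x \<otimes>\<^bsub>X\<^esub> x') <#\<^bsub>G\<^esub> y = i x <#\<^bsub>G\<^esub> (i x' <#\<^bsub>G\<^esub> y)"
      if "x \<in> carrier X" "x' \<in> carrier X" "y \<in> (\<lambda>g. g <#\<^bsub>G\<^esub> N) ` carrier G" for x x' y
      using that ic NG by (auto simp: G.lcos_m_assoc hom_mult[OF i] G.m_assoc)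
    show "x = \<one>\<^bsub>X\<^esub>" if x: "x \<in> carrier X" and y: "y \<in> (\<lambda>g. g <#\<^bsub>G\<^esub> N) ` carrier G"
      and eq: "i x <#\<^bsub>G\<^esub> y = y" for x y
    proof -
      obtain g where g: "g \<in> carrier G" "y = g <#\<^bsub>G\<^esub> N" using y by blast
      have "(i x \<otimes>\<^bsub>G\<^esub> g) <#\<^bsub>G\<^esub> N = g <#\<^bsub>G\<^esub> N"
        using eq g x ic NG by (simp add: G.lcos_m_assoc)
      moreover have "i x \<otimes>\<^bsub>G\<^esub> g \<in> (i x \<otimes>\<^bsub>G\<^esub> g) <#\<^bsub>G\<^esub> N"
        using g x ic by (intro coset_self[OF N]) auto
      ultimately obtain n where n: "n \<in> N" "i x \<otimes>\<^bsub>G\<^esub> g = g \<otimes>\<^bsub>G\<^esub> n"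
        by (auto simp: l_coset_def)
      have "inv\<^bsub>G\<^esub> g \<otimes>\<^bsub>G\<^esub> i x \<otimes>\<^bsub>G\<^esub> g = n"
        using n g x ic NG by (auto simp: G.m_assoc G.inv_solve_left' subset_iff)
      then show ?thesis using free[OF x g(1)] n(1) by simp
    qed
  qed
qed

lemma inl_hom: "(\<lambda>a. cls [Inl a]) \<in> hom A G"
  using amalg_inl_hom[OF amalgam_data] by (simp add: amalg_inl_def[abs_def])

lemma inr_hom: "(\<lambda>b. cls [Inr b]) \<in> hom B G"
  using amalg_inr_hom[OF amalgam_data] by (simp add: amalg_inr_def[abs_def])

text \<open>The hypotheses on \<^term>\<open>N\<close> say that both factors act freely on its cosets.  The points to be
kept are the finitely many cosets met on the way from \<^term>\<open>N\<close> along chosen words for the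
elements of \<^term>\<open>F\<close>.\<close>
theorem finite_amalgam_cosets_separated:
  assumes fin: "finite (carrier A)" "finite (carrier B)" and N: "subgroup N G"
    and free_A: "\<And>a g. a \<in> carrier A \<Longrightarrow> g \<in> carrier G \<Longrightarrow>
      inv\<^bsub>G\<^esub> g \<otimes>\<^bsub>G\<^esub> cls [Inl a] \<otimes>\<^bsub>G\<^esub> g \<in> N \<Longrightarrow> a = \<one>\<^bsub>A\<^esub>"
    and free_B: "\<And>b g. b \<in> carrier B \<Longrightarrow> g \<in> carrier G \<Longrightarrow>
      inv\<^bsub>G\<^esub> g \<otimes>\<^bsub>G\<^esub> cls [Inr b] \<otimes>\<^bsub>G\<^esub> g \<in> N \<Longrightarrow> b = \<one>\<^bsub>B\<^esub>"
    and F: "finite F" "F \<subseteq> carrier G"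
  shows "\<exists>(X :: (('a + 'b) list set set \<times> 'b) set) \<psi>. finite X \<and> \<psi> \<in> hom G (BijGroup X) \<and>
    (\<forall>g\<in>F. (N, \<one>\<^bsub>B\<^esub>) \<in> X \<and> \<psi> g (N, \<one>\<^bsub>B\<^esub>) = (g <#\<^bsub>G\<^esub> N, \<one>\<^bsub>B\<^esub>))"
proof -
  have NG: "N \<subseteq> carrier G" by (rule subgroup.subset[OF N])
  have "\<forall>g\<in>F. \<exists>u. u \<in> words \<and> cls u = g" using F(2) by (metis carrierE subsetD)
  then obtain w where w: "\<And>g. g \<in> F \<Longrightarrow> w g \<in> words \<and> cls (w g) = g" by metis
  define D where "D = (\<Union>g\<in>F. (\<lambda>i. cls (drop i (w g)) <#\<^bsub>G\<^esub> N) ` {..length (w g)})"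
  define Y where "Y = (\<lambda>g. g <#\<^bsub>G\<^esub> N) ` carrier G"
  have drop_words: "drop i (w g) \<in> words" if "g \<in> F" for i g
    using w[OF that] by (auto dest: in_set_dropD)
  have D: "finite D" "D \<subseteq> Y"
    using F(1) drop_words cls_carrier by (auto simp: D_def Y_def simp del: in_lists_conv_set)
  have FA: "free_set_action A Y (\<lambda>a y. cls [Inl a] <#\<^bsub>G\<^esub> y)"
    unfolding Y_def by (rule coset_action[OF N inl_hom A.group_axioms free_A])
  have FB: "free_set_action B Y (\<lambda>b y. cls [Inr b] <#\<^bsub>G\<^esub> y)"
    unfolding Y_def by (rule coset_action[OF N inr_hom B.group_axioms free_B])
  obtain X :: "(('a + 'b) list set set \<times> 'b) set" and \<psi>
    where X: "finite X" "\<psi> \<in> hom G (BijGroup X)" and ext: "\<forall>y\<in>D. (y, \<one>\<^bsub>B\<^esub>) \<in> X \<and>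
      (\<forall>a\<in>carrier A. \<psi> (cls [Inl a]) (y, \<one>\<^bsub>B\<^esub>) = (cls [Inl a] <#\<^bsub>G\<^esub> y, \<one>\<^bsub>B\<^esub>)) \<and>
      (\<forall>b\<in>carrier B. \<psi> (cls [Inr b]) (y, \<one>\<^bsub>B\<^esub>) = (cls [Inr b] <#\<^bsub>G\<^esub> y, \<one>\<^bsub>B\<^esub>))"
    using finite_extension[OF fin FA FB _ D] cls_amalg by auto
  have move: "\<psi> g (N, \<one>\<^bsub>B\<^esub>) = (g <#\<^bsub>G\<^esub> N, \<one>\<^bsub>B\<^esub>)" if "g \<in> F" for g
  proof -
    have "\<psi> (cls (w g)) (N, \<one>\<^bsub>B\<^esub>) = (cls (w g) <#\<^bsub>G\<^esub> N, \<one>\<^bsub>B\<^esub>)"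
      using w[OF that] that ext
      by (intro word_in_finite_extension[OF X(2) N, where D = D]) (auto simp: D_def)
    then show ?thesis using w[OF that] by simp
  qed
  have "(N, \<one>\<^bsub>B\<^esub>) \<in> X" if "g \<in> F" for g
  proof -
    have "cls (drop (length (w g)) (w g)) <#\<^bsub>G\<^esub> N \<in> D" using that unfolding D_def by blast
    then have "N \<in> D" using G.lcos_mult_one[OF NG] by (simp add: one_cls)
    then show ?thesis using ext by blast
  qed
  then show ?thesis using X move by blast
qed

text \<open>An infinite cyclic subgroup \<open>C\<close> has no torsion and meets the conjugates of the finite factors
trivially; then \<^term>\<open>c\<close> fixes the base point \<open>C\<close> of a finite \<^term>\<open>G\<close>-set while
\<^term>\<open>g\<close> moves it.  A finite \<open>C\<close> is handled with the regular action, where the finitely many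
elements of \<open>C\<close> and \<^term>\<open>g\<close> send the base point to different points.\<close>
lemma finite_amalgam_cyclic_separable:
  assumes fin: "finite (carrier A)" "finite (carrier B)"
    and c: "c \<in> carrier G" and g: "g \<in> carrier G" "g \<notin> generate G {c}"
  shows "\<exists>(X :: (('a + 'b) list set set \<times> 'b) set) \<psi>. finite X \<and> \<psi> \<in> hom G (BijGroup X) \<and>
    \<psi> g \<notin> \<psi> ` generate G {c}"
proof -
  define C where "C = generate G {c}"
  have C: "subgroup C G" unfolding C_def using c by (intro G.generate_is_subgroup) auto
  have cC: "c \<in> C" unfolding C_def by (rule generate.incl) simp
  have inv_conj: "x = \<one>\<^bsub>G\<^esub>" if "inv\<^bsub>G\<^esub> y \<otimes>\<^bsub>G\<^esub> x \<otimes>\<^bsub>G\<^esub> y = \<one>\<^bsub>G\<^esub>" "x \<in> carrier G" "y \<in> carrier G" for x y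
    using that by (metis G.inv_closed G.inv_solve_left' G.inv_solve_right' G.l_one G.m_closed G.r_inv G.r_one)
  show ?thesis
  proof (cases "finite C")
    case True
    have one: "subgroup {\<one>\<^bsub>G\<^esub>} G" by (rule G.triv_subgroup)
    have "\<exists>(X :: (('a + 'b) list set set \<times> 'b) set) \<psi>. finite X \<and> \<psi> \<in> hom G (BijGroup X) \<and>
        (\<forall>g\<in>insert g C. ({\<one>\<^bsub>G\<^esub>}, \<one>\<^bsub>B\<^esub>) \<in> X \<and> \<psi> g ({\<one>\<^bsub>G\<^esub>}, \<one>\<^bsub>B\<^esub>) = (g <#\<^bsub>G\<^esub> {\<one>\<^bsub>G\<^esub>}, \<one>\<^bsub>B\<^esub>))"
    proof (rule finite_amalgam_cosets_separated[OF fin one])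
      show "a = \<one>\<^bsub>A\<^esub>" if "a \<in> carrier A" "y \<in> carrier G"
        "inv\<^bsub>G\<^esub> y \<otimes>\<^bsub>G\<^esub> cls [Inl a] \<otimes>\<^bsub>G\<^esub> y \<in> {\<one>\<^bsub>G\<^esub>}" for a y
        using that inv_conj[of y "cls [Inl a]"] inl_eq_one hom_in_carrier[OF inl_hom that(1)] by simp
      show "b = \<one>\<^bsub>B\<^esub>" if "b \<in> carrier B" "y \<in> carrier G"
        "inv\<^bsub>G\<^esub> y \<otimes>\<^bsub>G\<^esub> cls [Inr b] \<otimes>\<^bsub>G\<^esub> y \<in> {\<one>\<^bsub>G\<^esub>}" for b y
        using that inv_conj[of y "cls [Inr b]"] inr_eq_one hom_in_carrier[OF inr_hom that(1)] by simp
    qed (use True g C subgroup.subset in auto)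
    then obtain X :: "(('a + 'b) list set set \<times> 'b) set" and \<psi> where
      X: "finite X" "\<psi> \<in> hom G (BijGroup X)"
      "\<And>d. d \<in> insert g C \<Longrightarrow> \<psi> d ({\<one>\<^bsub>G\<^esub>}, \<one>\<^bsub>B\<^esub>) = (d <#\<^bsub>G\<^esub> {\<one>\<^bsub>G\<^esub>}, \<one>\<^bsub>B\<^esub>)" by blast
    have "d <#\<^bsub>G\<^esub> {\<one>\<^bsub>G\<^esub>} = {d}" if "d \<in> carrier G" for d using that by (simp add: l_coset_def)
    then have "\<psi> g \<noteq> \<psi> d" if "d \<in> C" for d
      using X(3)[of d] X(3)[of g] that g C_def subgroup.mem_carrier[OF C that] by auto
    then show ?thesis using X(1,2) unfolding C_def by blast
  next
    case False
    have torsion_free: "z = \<one>\<^bsub>G\<^esub>" if z: "z \<in> C" "z [^]\<^bsub>G\<^esub> n = \<one>\<^bsub>G\<^esub>" and n: "n \<noteq> 0" for z and n :: nat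
    proof -
      obtain k :: int where k: "z = c [^]\<^bsub>G\<^esub> k" using z(1) G.generate_pow[OF c] C_def by auto
      have "c [^]\<^bsub>G\<^esub> (k * int n) = \<one>\<^bsub>G\<^esub>"
        using z(2) c k G.int_pow_pow[OF c, of k "int n"] by (simp add: int_pow_int)
      moreover have "infinite (carrier (subgroup_generated G {c}))"
        using False c by (simp add: C_def carrier_subgroup_generated Int_absorb1)
      ultimately have "k * int n = 0"
        using G.infinite_cyclic_subgroup_int[OF c] by (metis int_pow_0)
      then show ?thesis using n k by simp
    qed
    have conj_torsion: "x = \<one>\<^bsub>X\<^esub>"
      if X: "group X" "finite (carrier X)" and i: "i \<in> hom X G"
        and inj: "\<And>x. x \<in> carrier X \<Longrightarrow> i x = \<one>\<^bsub>G\<^esub> \<Longrightarrow> x = \<one>\<^bsub>X\<^esub>"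
        and x: "x \<in> carrier X" and y: "y \<in> carrier G" "inv\<^bsub>G\<^esub> y \<otimes>\<^bsub>G\<^esub> i x \<otimes>\<^bsub>G\<^esub> y \<in> C"
      for X :: "('x, 'k) monoid_scheme" and i x y
    proof -
      interpret X: group X by fact
      have ix: "i x \<in> carrier G" by (rule hom_in_carrier[OF i x])
      have pow: "(inv\<^bsub>G\<^esub> y \<otimes>\<^bsub>G\<^esub> i x \<otimes>\<^bsub>G\<^esub> y) [^]\<^bsub>G\<^esub> n = inv\<^bsub>G\<^esub> y \<otimes>\<^bsub>G\<^esub> (i x [^]\<^bsub>G\<^esub> n) \<otimes>\<^bsub>G\<^esub> y" for n :: nat
      proof (induction n)
        case (Suc n)
        have "y \<otimes>\<^bsub>G\<^esub> (inv\<^bsub>G\<^esub> y \<otimes>\<^bsub>G\<^esub> z) = z" if "z \<in> carrier G" for z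
          using that y(1) by (simp add: G.m_assoc[symmetric])
        then show ?case using Suc ix y(1) by (simp add: G.m_assoc)
      qed (use y in simp)
      have "i x [^]\<^bsub>G\<^esub> order X = i (x [^]\<^bsub>X\<^esub> order X)"
        using hom_nat_pow[OF i x X(1) G.group_axioms] by simp
      also have "\<dots> = \<one>\<^bsub>G\<^esub>"
        using X.pow_order_eq_1[OF x] hom_one[OF i X(1) G.group_axioms] by simp
      finally have "inv\<^bsub>G\<^esub> y \<otimes>\<^bsub>G\<^esub> i x \<otimes>\<^bsub>G\<^esub> y = \<one>\<^bsub>G\<^esub>"
        using torsion_free[OF y(2), of "order X"] pow X(2) y(1) X.order_gt_0_iff_finite by simp
      then show ?thesis using inv_conj[OF _ ix y(1)] inj[OF x] by simp
    qed
    have "\<exists>(X :: (('a + 'b) list set set \<times> 'b) set) \<psi>. finite X \<and> \<psi> \<in> hom G (BijGroup X) \<and>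
        (\<forall>g\<in>{c, g}. (C, \<one>\<^bsub>B\<^esub>) \<in> X \<and> \<psi> g (C, \<one>\<^bsub>B\<^esub>) = (g <#\<^bsub>G\<^esub> C, \<one>\<^bsub>B\<^esub>))"
    proof (rule finite_amalgam_cosets_separated[OF fin C])
      show "a = \<one>\<^bsub>A\<^esub>" if "a \<in> carrier A" "y \<in> carrier G"
        "inv\<^bsub>G\<^esub> y \<otimes>\<^bsub>G\<^esub> cls [Inl a] \<otimes>\<^bsub>G\<^esub> y \<in> C" for a y
        by (rule conj_torsion[OF A.group_axioms fin(1) inl_hom inl_eq_one that])
      show "b = \<one>\<^bsub>B\<^esub>" if "b \<in> carrier B" "y \<in> carrier G"
        "inv\<^bsub>G\<^esub> y \<otimes>\<^bsub>G\<^esub> cls [Inr b] \<otimes>\<^bsub>G\<^esub> y \<in> C" for b y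
        by (rule conj_torsion[OF B.group_axioms fin(2) inr_hom inr_eq_one that])
    qed (use c g in auto)
    then obtain X :: "(('a + 'b) list set set \<times> 'b) set" and \<psi> where
      X: "finite X" "\<psi> \<in> hom G (BijGroup X)" "(C, \<one>\<^bsub>B\<^esub>) \<in> X"
      "\<psi> c (C, \<one>\<^bsub>B\<^esub>) = (c <#\<^bsub>G\<^esub> C, \<one>\<^bsub>B\<^esub>)" "\<psi> g (C, \<one>\<^bsub>B\<^esub>) = (g <#\<^bsub>G\<^esub> C, \<one>\<^bsub>B\<^esub>)" by blast
    interpret \<psi>: group_hom G "BijGroup X" \<psi>
      using X(2) by (intro group_hom.intro G.group_axioms group_BijGroup group_hom_axioms.intro)
    have comp: "\<psi> (x \<otimes>\<^bsub>G\<^esub> y) z = \<psi> x (\<psi> y z)"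
      if "x \<in> carrier G" "y \<in> carrier G" "z \<in> X" for x y z
      using that \<psi>.hom_mult[OF that(1,2)] \<psi>.hom_closed[OF that(1)] \<psi>.hom_closed[OF that(2)]
      by (simp add: BijGroup_def compose_def)
    have id: "\<psi> \<one>\<^bsub>G\<^esub> z = z" if "z \<in> X" for z
      using that \<psi>.hom_one by (simp add: BijGroup_def)
    define stab where "stab = {d \<in> carrier G. \<psi> d (C, \<one>\<^bsub>B\<^esub>) = (C, \<one>\<^bsub>B\<^esub>)}"
    have "subgroup stab G"
    proof
      show "inv\<^bsub>G\<^esub> d \<in> stab" if "d \<in> stab" for d
        using that comp[of "inv\<^bsub>G\<^esub> d" d "(C, \<one>\<^bsub>B\<^esub>)"] id[OF X(3)] X(3) by (auto simp: stab_def)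
    qed (use comp id X(3) in \<open>auto simp: stab_def\<close>)
    moreover have "c \<in> stab"
      using X(4) c cC G.coset_join3[OF c C] by (simp add: stab_def)
    ultimately have "C \<subseteq> stab" unfolding C_def by (intro G.generate_subgroup_incl) auto
    moreover have "g <#\<^bsub>G\<^esub> C \<noteq> C"
      using coset_self[OF C g(1)] g(2) C_def by auto
    ultimately have "\<psi> g \<noteq> \<psi> d" if "d \<in> C" for d
      using that X(5) by (auto simp: stab_def)
    then show ?thesis using X(1,2) unfolding C_def by blast
  qed
qed

end

section \<open>Finite quotients and conjugation\<close>

lemma (in group) rcos_eq_iff:
  assumes "subgroup N G" "x \<in> carrier G" "y \<in> carrier G"
  shows "N #> x = N #> y \<longleftrightarrow> x \<otimes> inv y \<in> N"
proof
  have sub: "N \<subseteq> carrier G" by (rule subgroup.subset[OF assms(1)])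
  show "x \<otimes> inv y \<in> N" if "N #> x = N #> y"
    by (rule coset_join1[OF coset_mult_inv2[OF that assms(2,3) sub] _ assms(1)])
      (simp add: assms)
  show "N #> x = N #> y" if "x \<otimes> inv y \<in> N"
    by (rule coset_mult_inv1[OF coset_join2[OF _ assms(1) that] assms(2,3) sub])
      (simp add: assms)
qed

lemma finite_BijGroup:
  assumes "finite X"
  shows "finite (carrier (BijGroup X))"
proof -
  have "carrier (BijGroup X) \<subseteq> X \<rightarrow>\<^sub>E X"
    by (auto simp: BijGroup_def Bij_def bij_betw_def PiE_def)
  then show ?thesis using assms finite_PiE[of X "\<lambda>_. X"] finite_subset by blast
qed

text \<open>The finite permutation groups above act on pairs of a coset and an element of a factor; their
subgroups are copied to natural numbers, as \<^const>\<open>finitely_separable\<close> demands.\<close>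
lemma separating_epimorphism_onto_nat_group:
  assumes G: "group G" and L: "group L" "finite (carrier L)" and \<psi>: "\<psi> \<in> hom G L"
    and F: "F \<subseteq> carrier G" "g \<in> carrier G" "\<psi> g \<notin> \<psi> ` F"
  shows "\<exists>(Q :: nat monoid) \<psi>'. group Q \<and> finite (carrier Q) \<and> \<psi>' \<in> epi G Q \<and> \<psi>' g \<notin> \<psi>' ` F"
proof -
  interpret G: group G by fact
  interpret L: group L by fact
  obtain e :: "_ \<Rightarrow> nat" where e: "inj_on e (carrier L)"
    using L(2) finite_imp_inj_to_nat_seg by blast
  define d where "d = inv_into (carrier L) e"
  have d: "d (e x) = x" if "x \<in> carrier L" for x using e that by (simp add: d_def)
  define Q0 :: "nat monoid" where "Q0 = \<lparr>carrier = UNIV, mult = (\<lambda>m n. e (d m \<otimes>\<^bsub>L\<^esub> d n)), one = e \<one>\<^bsub>L\<^esub>\<rparr>"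
  define h where "h = e \<circ> \<psi>"
  define Q where "Q = Q0\<lparr>carrier := h ` carrier G, one := h \<one>\<^bsub>G\<^esub>\<rparr>"
  have \<psi>c: "\<psi> x \<in> carrier L" if "x \<in> carrier G" for x by (rule hom_in_carrier[OF \<psi> that])
  have "h \<in> hom G Q0"
    by (rule homI) (auto simp: h_def Q0_def d \<psi>c hom_mult[OF \<psi>])
  then have Q: "group Q" "h \<in> hom G Q"
    using G.hom_imp_img_group by (auto simp: Q_def hom_def)
  have "h \<in> epi G Q" using Q(2) by (auto simp: epi_def Q_def)
  moreover have "finite (carrier Q)"
  proof -
    have "h ` carrier G \<subseteq> e ` carrier L" using \<psi>c by (auto simp: h_def)
    then show ?thesis using L(2) finite_subset by (auto simp: Q_def)
  qed
  moreover have "h g \<notin> h ` F"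
  proof
    assume "h g \<in> h ` F"
    then obtain f where "f \<in> F" "e (\<psi> g) = e (\<psi> f)" by (auto simp: h_def)
    then show False using F inj_onD[OF e] \<psi>c by blast
  qed
  ultimately show ?thesis using Q(1) by blast
qed

lemma (in group) conjugation_hom:
  assumes "g \<in> carrier G"
  shows "(\<lambda>x. inv g \<otimes> x \<otimes> g) \<in> hom G G"
proof (rule homI)
  have "g \<otimes> (inv g \<otimes> x) = x" if "x \<in> carrier G" for x
    using that assms by (simp add: m_assoc[symmetric])
  then show "inv g \<otimes> (x \<otimes> y) \<otimes> g = inv g \<otimes> x \<otimes> g \<otimes> (inv g \<otimes> y \<otimes> g)"
    if "x \<in> carrier G" "y \<in> carrier G" for x y
    using that assms by (simp add: m_assoc)
qed (use assms in simp)

lemma (in group) finitely_separable_conjugate: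
  assumes D: "finitely_separable D G" and C: "conjugate_in G C D"
  shows "finitely_separable C G"
proof -
  obtain g where g: "g \<in> carrier G" and Cg: "C = (\<lambda>x. inv g \<otimes> x \<otimes> g) ` D"
    using C by (auto simp: conjugate_in_def)
  have DG: "subgroup D G" using D by (simp add: finitely_separable_def)
  then have Dc: "x \<in> carrier G" if "x \<in> D" for x using that by (rule subgroup.mem_carrier)
  have canc: "g \<otimes> (inv g \<otimes> x) = x" "inv g \<otimes> (g \<otimes> x) = x" if "x \<in> carrier G" for x
    using that g by (simp_all add: m_assoc[symmetric])
  interpret conj: group_hom G G "\<lambda>x. inv g \<otimes> x \<otimes> g"
    using conjugation_hom[OF g] by unfold_locales
  have "subgroup C G" unfolding Cg by (rule conj.subgroup_img_is_subgroup[OF DG])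
  moreover have "\<exists>(Q :: nat monoid) \<psi>. group Q \<and> finite (carrier Q) \<and> \<psi> \<in> epi G Q \<and> \<psi> y \<notin> \<psi> ` C"
    if y: "y \<in> carrier G - C" for y
  proof -
    have "g \<otimes> y \<otimes> inv g \<notin> D"
    proof
      assume "g \<otimes> y \<otimes> inv g \<in> D"
      then have "inv g \<otimes> (g \<otimes> y \<otimes> inv g) \<otimes> g \<in> C" unfolding Cg by blast
      then show False using y g by (simp add: m_assoc canc)
    qed
    then obtain Q :: "nat monoid" and \<psi> where Q: "group Q" "finite (carrier Q)" "\<psi> \<in> epi G Q"
      "\<psi> (g \<otimes> y \<otimes> inv g) \<notin> \<psi> ` D"
      using D y g unfolding finitely_separable_def by (metis DiffD1 DiffI inv_closed m_closed)
    interpret Q: group Q by fact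
    have \<psi>: "\<psi> \<in> hom G Q" using Q(3) by (simp add: epi_def)
    have "\<psi> y \<noteq> \<psi> (inv g \<otimes> x \<otimes> g)" if x: "x \<in> D" for x
    proof
      assume eq: "\<psi> y = \<psi> (inv g \<otimes> x \<otimes> g)"
      have "\<psi> (g \<otimes> y \<otimes> inv g) = \<psi> g \<otimes>\<^bsub>Q\<^esub> \<psi> (inv g \<otimes> x \<otimes> g) \<otimes>\<^bsub>Q\<^esub> \<psi> (inv g)"
        using y g by (simp add: hom_mult[OF \<psi>] eq)
      also have "\<dots> = \<psi> (g \<otimes> (inv g \<otimes> x \<otimes> g) \<otimes> inv g)"
        using Dc[OF x] g by (simp add: hom_mult[OF \<psi>])
      also have "g \<otimes> (inv g \<otimes> x \<otimes> g) \<otimes> inv g = x"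
        using Dc[OF x] g by (simp add: m_assoc canc)
      finally show False using Q(4) x by blast
    qed
    then have "\<psi> y \<notin> \<psi> ` C" unfolding Cg by blast
    then show ?thesis using Q by blast
  qed
  ultimately show ?thesis by (simp add: finitely_separable_def)
qed

section \<open>The amalgam of two compatible quotients\<close>

locale amalgam_quotient = amalgam A B H K \<phi>
  for A :: "('a, 'm) monoid_scheme" and B :: "('b, 'n) monoid_scheme"
    and H :: "'a set" and K :: "'b set" and \<phi> :: "'a \<Rightarrow> 'b" +
  fixes R :: "'a set" and S :: "'b set"
  assumes R: "R \<lhd> A" and S: "S \<lhd> B" and compat: "compatible H K \<phi> R S"
begin

definition HR :: "'a set set" where "HR = (\<lambda>h. R #>\<^bsub>A\<^esub> h) ` H"
definition KS :: "'b set set" where "KS = (\<lambda>k. S #>\<^bsub>B\<^esub> k) ` K"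
text \<open>The map \<open>Rh \<mapsto> S \<phi>(h)\<close>, by way of an arbitrary representative in \<^term>\<open>H\<close>; that the choice does
not matter is \<open>coset_correspondence\<close>.\<close>
definition \<phi>RS :: "'a set \<Rightarrow> 'b set" where
  "\<phi>RS U = S #>\<^bsub>B\<^esub> \<phi> (inv_into H (\<lambda>h. R #>\<^bsub>A\<^esub> h) U)"

lemma R_sub: "subgroup R A" using R by (rule normal_imp_subgroup)
lemma S_sub: "subgroup S B" using S by (rule normal_imp_subgroup)

lemma \<phi>_div:
  assumes "h \<in> H" "k \<in> H"
  shows "\<phi> (h \<otimes>\<^bsub>A\<^esub> inv\<^bsub>A\<^esub> k) = \<phi> h \<otimes>\<^bsub>B\<^esub> inv\<^bsub>B\<^esub> (\<phi> k)"
proof -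
  have c: "\<phi> h \<in> carrier B" "\<phi> k \<in> carrier B" "\<phi> (h \<otimes>\<^bsub>A\<^esub> inv\<^bsub>A\<^esub> k) \<in> carrier B"
    using assms \<phi>_K K.mem_carrier by auto
  have "\<phi> (h \<otimes>\<^bsub>A\<^esub> inv\<^bsub>A\<^esub> k) \<otimes>\<^bsub>B\<^esub> \<phi> k = \<phi> (h \<otimes>\<^bsub>A\<^esub> inv\<^bsub>A\<^esub> k \<otimes>\<^bsub>A\<^esub> k)"
    using assms by (simp add: \<phi>_mult)
  also have "h \<otimes>\<^bsub>A\<^esub> inv\<^bsub>A\<^esub> k \<otimes>\<^bsub>A\<^esub> k = h"
    using assms by (simp add: A.m_assoc)
  finally show ?thesis using c by (simp add: B.inv_solve_right)
qed

text \<open>This is what compatibility means: left to right makes the induced map well defined, right to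
left makes it injective.\<close>
lemma coset_correspondence:
  assumes "h \<in> H" "k \<in> H"
  shows "R #>\<^bsub>A\<^esub> h = R #>\<^bsub>A\<^esub> k \<longleftrightarrow> S #>\<^bsub>B\<^esub> \<phi> h = S #>\<^bsub>B\<^esub> \<phi> k"
proof -
  let ?d = "h \<otimes>\<^bsub>A\<^esub> inv\<^bsub>A\<^esub> k"
  have d: "?d \<in> H" using assms by simp
  have "?d \<in> R \<longleftrightarrow> \<phi> ?d \<in> S"
  proof
    show "\<phi> ?d \<in> S" if "?d \<in> R" using that d compat by (auto simp: compatible_def)
    assume "\<phi> ?d \<in> S"
    then have "\<phi> ?d \<in> \<phi> ` (R \<inter> H)" using compat d \<phi>_K by (simp add: compatible_def)
    then show "?d \<in> R" using d \<phi>_bij by (auto simp: bij_betw_def inj_on_def)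
  qed
  then show ?thesis
    using assms \<phi>_K A.rcos_eq_iff[OF R_sub, of h k] B.rcos_eq_iff[OF S_sub, of "\<phi> h" "\<phi> k"]
    by (simp add: \<phi>_div)
qed

lemma \<phi>RS_coset:
  assumes "h \<in> H"
  shows "\<phi>RS (R #>\<^bsub>A\<^esub> h) = S #>\<^bsub>B\<^esub> \<phi> h"
proof -
  let ?k = "inv_into H (\<lambda>h. R #>\<^bsub>A\<^esub> h) (R #>\<^bsub>A\<^esub> h)"
  have im: "R #>\<^bsub>A\<^esub> h \<in> (\<lambda>h. R #>\<^bsub>A\<^esub> h) ` H" using assms by (rule imageI)
  have "R #>\<^bsub>A\<^esub> ?k = R #>\<^bsub>A\<^esub> h" by (rule f_inv_into_f[OF im])
  then show ?thesis
    unfolding \<phi>RS_def by (rule coset_correspondence[OF inv_into_into[OF im] assms, THEN iffD1])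
qed

lemma projA_hom: "(\<lambda>a. R #>\<^bsub>A\<^esub> a) \<in> hom A (A Mod R)"
  by (rule normal.r_coset_hom_Mod[OF R])

lemma projB_hom: "(\<lambda>b. S #>\<^bsub>B\<^esub> b) \<in> hom B (B Mod S)"
  by (rule normal.r_coset_hom_Mod[OF S])

sublocale projA: group_hom A "A Mod R" "\<lambda>a. R #>\<^bsub>A\<^esub> a"
  by (intro group_hom.intro group_hom_axioms.intro A.group_axioms projA_hom
      normal.factorgroup_is_group[OF R])

sublocale projB: group_hom B "B Mod S" "\<lambda>b. S #>\<^bsub>B\<^esub> b"
  by (intro group_hom.intro group_hom_axioms.intro B.group_axioms projB_hom
      normal.factorgroup_is_group[OF S])

lemma \<phi>RS_iso: "\<phi>RS \<in> iso ((A Mod R)\<lparr>carrier := HR\<rparr>) ((B Mod S)\<lparr>carrier := KS\<rparr>)"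
proof (rule isoI)
  show "\<phi>RS \<in> hom ((A Mod R)\<lparr>carrier := HR\<rparr>) ((B Mod S)\<lparr>carrier := KS\<rparr>)"
  proof (rule homI)
    fix U V assume "U \<in> carrier ((A Mod R)\<lparr>carrier := HR\<rparr>)" "V \<in> carrier ((A Mod R)\<lparr>carrier := HR\<rparr>)"
    then obtain h k where hk: "h \<in> H" "k \<in> H" "U = R #>\<^bsub>A\<^esub> h" "V = R #>\<^bsub>A\<^esub> k"
      by (auto simp: HR_def)
    show "\<phi>RS U \<in> carrier ((B Mod S)\<lparr>carrier := KS\<rparr>)"
      using hk \<phi>_K by (auto simp: KS_def \<phi>RS_coset)
    have UV: "U \<otimes>\<^bsub>A Mod R\<^esub> V = R #>\<^bsub>A\<^esub> (h \<otimes>\<^bsub>A\<^esub> k)"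
      unfolding hk(3,4) by (rule projA.hom_mult[symmetric]) (use hk in auto)
    have "\<phi>RS (U \<otimes>\<^bsub>A Mod R\<^esub> V) = S #>\<^bsub>B\<^esub> (\<phi> h \<otimes>\<^bsub>B\<^esub> \<phi> k)"
      unfolding UV using hk(1,2) by (simp only: \<phi>RS_coset H.m_closed \<phi>_mult)
    also have "\<dots> = (S #>\<^bsub>B\<^esub> \<phi> h) \<otimes>\<^bsub>B Mod S\<^esub> (S #>\<^bsub>B\<^esub> \<phi> k)"
      by (rule projB.hom_mult) (use hk \<phi>_K in auto)
    also have "\<dots> = \<phi>RS U \<otimes>\<^bsub>B Mod S\<^esub> \<phi>RS V"
      unfolding hk(3,4) using hk(1,2) by (simp only: \<phi>RS_coset)
    finally show "\<phi>RS (U \<otimes>\<^bsub>(A Mod R)\<lparr>carrier := HR\<rparr>\<^esub> V) =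
        \<phi>RS U \<otimes>\<^bsub>(B Mod S)\<lparr>carrier := KS\<rparr>\<^esub> \<phi>RS V" by simp
  qed
  have "\<phi>RS ` HR = KS"
  proof -
    have "\<phi>RS ` HR = (\<lambda>h. S #>\<^bsub>B\<^esub> \<phi> h) ` H" by (auto simp: HR_def \<phi>RS_coset image_image)
    also have "\<dots> = (\<lambda>k. S #>\<^bsub>B\<^esub> k) ` \<phi> ` H" by (simp add: image_image)
    finally show ?thesis using bij_betw_imp_surj_on[OF \<phi>_bij] by (simp add: KS_def)
  qed
  moreover have "inj_on \<phi>RS HR"
    by (rule inj_onI) (auto simp: HR_def \<phi>RS_coset coset_correspondence[symmetric])
  ultimately show "bij_betw \<phi>RS (carrier ((A Mod R)\<lparr>carrier := HR\<rparr>)) (carrier ((B Mod S)\<lparr>carrier := KS\<rparr>))"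
    by (simp add: bij_betw_def)
qed

sublocale Q: amalgam "A Mod R" "B Mod S" HR KS \<phi>RS
proof (intro amalgam.intro amalgam_axioms.intro \<phi>RS_iso)
  show "subgroup HR (A Mod R)" unfolding HR_def
    by (rule projA.subgroup_img_is_subgroup[OF H.subgroup_axioms])
  show "subgroup KS (B Mod S)" unfolding KS_def
    by (rule projB.subgroup_img_is_subgroup[OF K.subgroup_axioms])
qed (rule projA.H.group_axioms projB.H.group_axioms)+

end

section \<open>Elements that survive modulo compatible pairs\<close>

context amalgam
begin

lemma generate_inl: "a \<in> carrier A \<Longrightarrow> generate G {cls [Inl a]} = (\<lambda>a. cls [Inl a]) ` generate A {a}"
  using group_hom.generate_img[of A G "\<lambda>a. cls [Inl a]" "{a}"] inl_hom
  by (simp add: group_hom_def group_hom_axioms_def A.group_axioms G.group_axioms)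

lemma generate_inr: "b \<in> carrier B \<Longrightarrow> generate G {cls [Inr b]} = (\<lambda>b. cls [Inr b]) ` generate B {b}"
  using group_hom.generate_img[of B G "\<lambda>b. cls [Inr b]" "{b}"] inr_hom
  by (simp add: group_hom_def group_hom_axioms_def B.group_axioms G.group_axioms)

lemma inl_inj: "inj_on (\<lambda>a. cls [Inl a]) (carrier A)"
proof -
  interpret i: group_hom A G "\<lambda>a. cls [Inl a]"
    using inl_hom by unfold_locales
  show ?thesis using inl_eq_one by (subst i.inj_on_one_iff) auto
qed

lemma inr_inj: "inj_on (\<lambda>b. cls [Inr b]) (carrier B)"
proof -
  interpret i: group_hom B G "\<lambda>b. cls [Inr b]"
    using inr_hom by unfold_locales
  show ?thesis using inr_eq_one by (subst i.inj_on_one_iff) auto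
qed

lemma syllables_one: "syllables \<one>\<^bsub>G\<^esub> = []"
  using syllables_reduced[of "[]"] by (simp add: one_cls reduced_word_def)

lemma in_range_inl_iff:
  assumes "g \<in> carrier G"
  shows "g \<in> (\<lambda>a. cls [Inl a]) ` carrier A \<longleftrightarrow> syllables g \<in> {[], [True]}"
proof
  show "g \<in> (\<lambda>a. cls [Inl a]) ` carrier A \<Longrightarrow> syllables g \<in> {[], [True]}"
    by (auto simp: syllables_A split: if_splits)
  assume syl: "syllables g \<in> {[], [True]}"
  show "g \<in> (\<lambda>a. cls [Inl a]) ` carrier A"
    using reduced_form[OF assms]
  proof (elim disjE bexE conjE)
    fix u assume u: "u \<in> words" "reduced_word H K u" "g = cls u"
    then have "map isl u \<in> {[], [True]}" using syl syllables_reduced by simp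
    then consider "u = []" | a where "u = [Inl a]" by (auto simp: map_eq_Cons_conv isl_def)
    then show ?thesis
    proof cases
      case 1
      then have "g = cls [Inl \<one>\<^bsub>A\<^esub>]" using u(3) cls_eqI[OF amalg_cong.one_A] by simp
      then show ?thesis by blast
    next
      case 2
      then show ?thesis using u by auto
    qed
  qed auto
qed

lemma in_range_inr_iff:
  assumes "g \<in> carrier G"
  shows "g \<in> (\<lambda>b. cls [Inr b]) ` carrier B \<longleftrightarrow> syllables g \<in> {[], [False]}"
proof
  show "g \<in> (\<lambda>b. cls [Inr b]) ` carrier B \<Longrightarrow> syllables g \<in> {[], [False]}"
    by (auto simp: syllables_B split: if_splits)
  assume syl: "syllables g \<in> {[], [False]}"
  show "g \<in> (\<lambda>b. cls [Inr b]) ` carrier B"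
    using reduced_form[OF assms]
  proof (elim disjE bexE conjE)
    fix u assume u: "u \<in> words" "reduced_word H K u" "g = cls u"
    then have "map isl u \<in> {[], [False]}" using syl syllables_reduced by simp
    then consider "u = []" | b where "u = [Inr b]"
      by (cases u; cases "hd u") auto
    then show ?thesis
    proof cases
      case 1
      then have "g = cls [Inr \<one>\<^bsub>B\<^esub>]" using u(3) cls_eqI[OF amalg_cong.one_B] by simp
      then show ?thesis by blast
    next
      case 2
      then show ?thesis using u by auto
    qed
  next
    fix h assume "h \<in> H" "g = cls [Inl h]"
    then show ?thesis using cls_amalg[of h] \<phi>_K[of h] by auto
  qed
qed

text \<open>Modulo \<open>(R, S)\<close> the element \<^term>\<open>g\<close> keeps its syllables, and it does not become trivial unless
it is trivial (\<open>rigid_syllables\<close>, \<open>rigid_trivial\<close>).  The second disjunct is needed for the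
elements without syllables, which have to be protected one by one.\<close>
definition rigid :: "('a + 'b) list set \<Rightarrow> 'a set \<Rightarrow> 'b set \<Rightarrow> bool" where
  "rigid g R S \<longleftrightarrow>
    (\<exists>u\<in>words. reduced_word (H <#>\<^bsub>A\<^esub> R) (K <#>\<^bsub>B\<^esub> S) u \<and> g = cls u) \<or>
    (\<exists>h\<in>H. g = cls [Inl h] \<and> (h \<in> R \<longrightarrow> h = \<one>\<^bsub>A\<^esub>))"

text \<open>Properties of pairs that pass to smaller pairs can be achieved simultaneously, by intersecting.\<close>
definition persistent :: "('a set \<Rightarrow> 'b set \<Rightarrow> bool) \<Rightarrow> bool" where
  "persistent P \<longleftrightarrow> (\<forall>R S R' S'. R' \<subseteq> R \<longrightarrow> S' \<subseteq> S \<longrightarrow> P R S \<longrightarrow> P R' S')"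

lemma persistentD: "persistent P \<Longrightarrow> R' \<subseteq> R \<Longrightarrow> S' \<subseteq> S \<Longrightarrow> P R S \<Longrightarrow> P R' S'"
  unfolding persistent_def by blast

lemma persistentI:
  "(\<And>R S R' S'. R' \<subseteq> R \<Longrightarrow> S' \<subseteq> S \<Longrightarrow> P R S \<Longrightarrow> P R' S') \<Longrightarrow> persistent P"
  unfolding persistent_def by blast

text \<open>Compatibility survives because the injective \<^term>\<open>\<phi>\<close> commutes with intersections, and the index stays
finite because a coset of the intersection is the intersection of two cosets.\<close>
lemma Omega_inter:
  assumes "(R, S) \<in> Omega A B H K \<phi>" "(R', S') \<in> Omega A B H K \<phi>"
  shows "(R \<inter> R', S \<inter> S') \<in> Omega A B H K \<phi>"
proof -
  have fin: "finite (rcosets\<^bsub>X\<^esub> (M \<inter> N))"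
    if "group X" "M \<lhd> X" "N \<lhd> X" "finite (rcosets\<^bsub>X\<^esub> M)" "finite (rcosets\<^bsub>X\<^esub> N)"
    for X :: "('x, 'k) monoid_scheme" and M N
  proof -
    interpret X: group X by fact
    have sub: "M \<subseteq> carrier X" "N \<subseteq> carrier X"
      using that(2,3) normal_imp_subgroup subgroup.subset by blast+
    have "(M \<inter> N) #>\<^bsub>X\<^esub> x = (M #>\<^bsub>X\<^esub> x) \<inter> (N #>\<^bsub>X\<^esub> x)" if x: "x \<in> carrier X" for x
    proof
      show "(M #>\<^bsub>X\<^esub> x) \<inter> (N #>\<^bsub>X\<^esub> x) \<subseteq> (M \<inter> N) #>\<^bsub>X\<^esub> x"
      proof
        fix z assume "z \<in> (M #>\<^bsub>X\<^esub> x) \<inter> (N #>\<^bsub>X\<^esub> x)"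
        then obtain m n where mn: "m \<in> M" "n \<in> N" "z = m \<otimes>\<^bsub>X\<^esub> x" "z = n \<otimes>\<^bsub>X\<^esub> x"
          by (auto simp: r_coset_def)
        moreover have "m = n" using mn x sub X.right_cancel[of x m n] by auto
        ultimately show "z \<in> (M \<inter> N) #>\<^bsub>X\<^esub> x" by (auto simp: r_coset_def)
      qed
    qed (auto simp: r_coset_def)
    then have "rcosets\<^bsub>X\<^esub> (M \<inter> N) \<subseteq> (\<lambda>(U, V). U \<inter> V) ` ((rcosets\<^bsub>X\<^esub> M) \<times> (rcosets\<^bsub>X\<^esub> N))"
      by (force simp: RCOSETS_def)
    then show ?thesis by (rule finite_subset) (use that(4,5) in simp)
  qed
  have "\<phi> ` (R \<inter> R' \<inter> H) = \<phi> ` (R \<inter> H) \<inter> \<phi> ` (R' \<inter> H)"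
    using inj_on_image_Int[of \<phi> H "R \<inter> H" "R' \<inter> H"] \<phi>_bij
    by (simp add: bij_betw_def Int_assoc Int_left_commute)
  then have "compatible H K \<phi> (R \<inter> R') (S \<inter> S')"
    using assms by (auto simp: Omega_def compatible_def)
  then show ?thesis
    using assms fin[OF A.group_axioms, of R R'] fin[OF B.group_axioms, of S S']
      A.normal_subgroup_intersect B.normal_subgroup_intersect
    by (auto simp: Omega_def)
qed

lemma Omega_top: "(carrier A, carrier B) \<in> Omega A B H K \<phi>"
proof -
  have "rcosets\<^bsub>X\<^esub> (carrier X) \<subseteq> {carrier X}" if "group X" for X :: "('x, 'k) monoid_scheme"
    using that by (auto simp: RCOSETS_def group.coset_join2 group.subgroup_self)
  then have "finite (rcosets\<^bsub>A\<^esub> carrier A)" "finite (rcosets\<^bsub>B\<^esub> carrier B)"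
    using A.group_axioms B.group_axioms by (meson finite.emptyI finite.insertI finite_subset)+
  moreover have "carrier A \<lhd> A" "carrier B \<lhd> B"
    by (auto intro!: A.normal_invI B.normal_invI A.subgroup_self B.subgroup_self)
  moreover have "\<phi> ` (carrier A \<inter> H) = carrier B \<inter> K"
    using \<phi>_bij H.subset K.subset by (simp add: bij_betw_def Int_absorb1)
  ultimately show ?thesis by (simp add: Omega_def compatible_def)
qed

lemma Omega_all:
  assumes "finite Ps"
    and "\<And>P. P \<in> Ps \<Longrightarrow> persistent P \<and> (\<exists>(R, S)\<in>Omega A B H K \<phi>. P R S)"
  shows "\<exists>R S. (R, S) \<in> Omega A B H K \<phi> \<and> (\<forall>P\<in>Ps. P R S)"
  using assms
proof (induction Ps)
  case empty
  then show ?case using Omega_top by blast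
next
  case (insert P Ps)
  obtain R S where RS: "(R, S) \<in> Omega A B H K \<phi>" "\<forall>P\<in>Ps. P R S" using insert by blast
  obtain R' S' where RS': "(R', S') \<in> Omega A B H K \<phi>" "P R' S'" using insert by blast
  have "P' (R \<inter> R') (S \<inter> S')" if "P' \<in> insert P Ps" for P'
  proof -
    have "persistent P'" using insert.prems that by blast
    then show ?thesis using RS(2) RS'(2) that unfolding persistent_def by (metis inf_le1 inf_le2 insertE)
  qed
  then show ?case using Omega_inter[OF RS(1) RS'(1)] by blast
qed

text \<open>This is the separability of \<^term>\<open>H\<close> and \<^term>\<open>K\<close> in the definition of a filtration.\<close>
lemma letters_outside:
  assumes filt: "filtration A H (Omega_A A B H K \<phi>)" "filtration B K (Omega_B A B H K \<phi>)"
    and x: "x \<in> carrier A <+> carrier B" "x \<notin> H <+> K"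
  shows "\<exists>(R, S)\<in>Omega A B H K \<phi>. x \<notin> (H <#>\<^bsub>A\<^esub> R) <+> (K <#>\<^bsub>B\<^esub> S)"
proof (cases x)
  case (Inl a)
  then have "a \<notin> carrier A \<inter> (\<Inter>N\<in>Omega_A A B H K \<phi>. H <#>\<^bsub>A\<^esub> N)"
    using x filt(1) by (simp add: filtration_def separable_by_def)
  then obtain R S where "(R, S) \<in> Omega A B H K \<phi>" "a \<notin> H <#>\<^bsub>A\<^esub> R"
    using Inl x by (auto simp: Omega_A_def)
  then show ?thesis using Inl by auto
next
  case (Inr b)
  then have "b \<notin> carrier B \<inter> (\<Inter>N\<in>Omega_B A B H K \<phi>. K <#>\<^bsub>B\<^esub> N)"
    using x filt(2) by (simp add: filtration_def separable_by_def)
  then obtain R S where "(R, S) \<in> Omega A B H K \<phi>" "b \<notin> K <#>\<^bsub>B\<^esub> S"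
    using Inr x by (auto simp: Omega_B_def)
  then show ?thesis using Inr by auto
qed

lemma persistent_outside: "persistent (\<lambda>R S. x \<notin> (H <#>\<^bsub>A\<^esub> R) <+> (K <#>\<^bsub>B\<^esub> S))"
proof -
  have "H <#>\<^bsub>A\<^esub> R' \<subseteq> H <#>\<^bsub>A\<^esub> R" "K <#>\<^bsub>B\<^esub> S' \<subseteq> K <#>\<^bsub>B\<^esub> S" if "R' \<subseteq> R" "S' \<subseteq> S" for R R' S S'
    using that by (simp_all add: mono_set_mult)
  then show ?thesis
    unfolding persistent_def by (cases x) (simp_all, meson subsetD, meson subsetD)
qed

lemma reduced_word_iff:
  "reduced_word H' K' u \<longleftrightarrow> distinct_adj (map isl u) \<and> (\<forall>x\<in>set u. x \<notin> H' <+> K')"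
  by (auto simp: reduced_word_def)

lemma persistent_reduced: "persistent (\<lambda>R S. reduced_word (H <#>\<^bsub>A\<^esub> R) (K <#>\<^bsub>B\<^esub> S) u)"
proof (rule persistentI)
  fix R S R' S' assume sub: "R' \<subseteq> R" "S' \<subseteq> S" and red: "reduced_word (H <#>\<^bsub>A\<^esub> R) (K <#>\<^bsub>B\<^esub> S) u"
  have "x \<notin> (H <#>\<^bsub>A\<^esub> R') <+> (K <#>\<^bsub>B\<^esub> S')" if "x \<in> set u" for x
    using persistentD[OF persistent_outside sub, of x] red that by (simp only: reduced_word_iff) blast
  then show "reduced_word (H <#>\<^bsub>A\<^esub> R') (K <#>\<^bsub>B\<^esub> S') u"
    using red by (simp only: reduced_word_iff) blast
qed

lemma rigid_word: "u \<in> words \<Longrightarrow> reduced_word (H <#>\<^bsub>A\<^esub> R) (K <#>\<^bsub>B\<^esub> S) u \<Longrightarrow> rigid (cls u) R S"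
  unfolding rigid_def by (intro disjI1 bexI[of _ u] conjI HOL.refl)

lemma rigid_amalgamated: "h \<in> H \<Longrightarrow> (h \<in> R \<Longrightarrow> h = \<one>\<^bsub>A\<^esub>) \<Longrightarrow> rigid (cls [Inl h]) R S"
  unfolding rigid_def by (intro disjI2 bexI[of _ h] conjI HOL.refl impI)

lemma rigid_cases:
  assumes "rigid g R S"
  obtains (word) u where "u \<in> words" "reduced_word (H <#>\<^bsub>A\<^esub> R) (K <#>\<^bsub>B\<^esub> S) u" "g = cls u"
  | (amalgamated) h where "h \<in> H" "g = cls [Inl h]" "h \<in> R \<Longrightarrow> h = \<one>\<^bsub>A\<^esub>"
  using assms unfolding rigid_def by (elim disjE bexE conjE) simp_all

lemma persistent_rigid: "persistent (rigid g)"
proof (rule persistentI)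
  fix R S R' S' assume sub: "R' \<subseteq> R" "S' \<subseteq> S" and "rigid g R S"
  from this(3) show "rigid g R' S'"
  proof (cases rule: rigid_cases)
    case (word u)
    then show ?thesis
      using rigid_word[OF word(1) persistentD[OF persistent_reduced sub word(2)]] by (simp only:)
  next
    case (amalgamated h)
    then show ?thesis using rigid_amalgamated[of h R' S'] sub(1) by (simp only:) blast
  qed
qed

lemma stays_reduced:
  assumes filt: "filtration A H (Omega_A A B H K \<phi>)" "filtration B K (Omega_B A B H K \<phi>)"
    and u: "u \<in> words" "reduced_word H K u"
  shows "\<exists>(R, S)\<in>Omega A B H K \<phi>. reduced_word (H <#>\<^bsub>A\<^esub> R) (K <#>\<^bsub>B\<^esub> S) u"
proof -
  define out where "out x = (\<lambda>R S. x \<notin> (H <#>\<^bsub>A\<^esub> R) <+> (K <#>\<^bsub>B\<^esub> S))" for x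
  have "persistent (out x) \<and> (\<exists>(R, S)\<in>Omega A B H K \<phi>. out x R S)" if "x \<in> set u" for x
  proof
    show "persistent (out x)"
      unfolding out_def by (rule persistent_outside)
    show "\<exists>(R, S)\<in>Omega A B H K \<phi>. out x R S"
      unfolding out_def using that u by (intro letters_outside[OF filt]) (auto simp: reduced_word_def)
  qed
  then have "\<exists>R S. (R, S) \<in> Omega A B H K \<phi> \<and> (\<forall>P\<in>out ` set u. P R S)"
    by (intro Omega_all) auto
  then obtain R S where "(R, S) \<in> Omega A B H K \<phi>" "\<forall>x\<in>set u. out x R S" by blast
  then show ?thesis using u(2) unfolding out_def reduced_word_iff by blast
qed

text \<open>For an element of \<^term>\<open>H\<close> the trivial intersection in the definition of a filtration
takes the place of separability.\<close>
lemma ex_rigid: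
  assumes filt: "filtration A H (Omega_A A B H K \<phi>)" "filtration B K (Omega_B A B H K \<phi>)"
    and g: "g \<in> carrier G"
  shows "\<exists>(R, S)\<in>Omega A B H K \<phi>. rigid g R S"
  using reduced_form[OF g]
proof (elim disjE bexE conjE)
  fix u assume u: "u \<in> words" "reduced_word H K u" "g = cls u"
  obtain R S where "(R, S) \<in> Omega A B H K \<phi>" "reduced_word (H <#>\<^bsub>A\<^esub> R) (K <#>\<^bsub>B\<^esub> S) u"
    using stays_reduced[OF filt u(1,2)] by blast
  then show ?thesis using rigid_word[OF u(1)] unfolding u(3) by blast
next
  fix h assume h: "h \<in> H" "g = cls [Inl h]"
  have "\<exists>(R, S)\<in>Omega A B H K \<phi>. h \<in> R \<longrightarrow> h = \<one>\<^bsub>A\<^esub>"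
  proof (cases "h = \<one>\<^bsub>A\<^esub>")
    case True
    then show ?thesis using Omega_top by blast
  next
    case False
    then have "h \<notin> carrier A \<inter> (\<Inter>N\<in>Omega_A A B H K \<phi>. N)"
      using filt(1) by (simp add: filtration_def)
    then obtain R S where "(R, S) \<in> Omega A B H K \<phi>" "h \<notin> R"
      using h(1) by (auto simp: Omega_A_def)
    then show ?thesis by blast
  qed
  then obtain R S where "(R, S) \<in> Omega A B H K \<phi>" "h \<in> R \<Longrightarrow> h = \<one>\<^bsub>A\<^esub>" by blast
  then show ?thesis using rigid_amalgamated[OF h(1), of R S] unfolding h(2) by blast
qed

end

section \<open>The homomorphism to the amalgam of the quotients\<close>

context amalgam_quotient
begin

definition proj :: "'a + 'b \<Rightarrow> 'a set + 'b set" where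
  "proj = map_sum (\<lambda>a. R #>\<^bsub>A\<^esub> a) (\<lambda>b. S #>\<^bsub>B\<^esub> b)"

lemma proj_words: "u \<in> words \<Longrightarrow> map proj u \<in> Q.words"
  by (induction u) (auto simp: proj_def)

lemma ex_quotient_map: "\<exists>\<rho>\<in>hom G Q.G. \<forall>u\<in>words. \<rho> (cls u) = Q.cls (map proj u)"
proof -
  have "\<exists>F\<in>hom G Q.G.
      (\<forall>a\<in>carrier A. F (amalg_inl A B H \<phi> a) = (\<lambda>a. Q.cls [Inl (R #>\<^bsub>A\<^esub> a)]) a) \<and>
      (\<forall>b\<in>carrier B. F (amalg_inr A B H \<phi> b) = (\<lambda>b. Q.cls [Inr (S #>\<^bsub>B\<^esub> b)]) b)"
  proof (rule amalg_product_lift[OF amalgam_data Q.G.group_axioms])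
    show "(\<lambda>a. Q.cls [Inl (R #>\<^bsub>A\<^esub> a)]) \<in> hom A Q.G"
      using hom_compose[OF projA_hom Q.inl_hom] by (simp add: comp_def)
    show "(\<lambda>b. Q.cls [Inr (S #>\<^bsub>B\<^esub> b)]) \<in> hom B Q.G"
      using hom_compose[OF projB_hom Q.inr_hom] by (simp add: comp_def)
    show "Q.cls [Inl (R #>\<^bsub>A\<^esub> h)] = Q.cls [Inr (S #>\<^bsub>B\<^esub> \<phi> h)]" if "h \<in> H" for h
      using Q.cls_amalg[of "R #>\<^bsub>A\<^esub> h"] that \<phi>RS_coset[OF that] by (simp add: HR_def)
  qed
  then obtain F where F: "F \<in> hom G Q.G"
    "\<And>a. a \<in> carrier A \<Longrightarrow> F (cls [Inl a]) = Q.cls [Inl (R #>\<^bsub>A\<^esub> a)]"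
    "\<And>b. b \<in> carrier B \<Longrightarrow> F (cls [Inr b]) = Q.cls [Inr (S #>\<^bsub>B\<^esub> b)]"
    by (auto simp: amalg_inl_def amalg_inr_def)
  have "F (cls u) = Q.cls (map proj u)" if "u \<in> words" for u
    using that
  proof (induction u)
    case Nil
    then show ?case using hom_one[OF F(1) G.group_axioms Q.G.group_axioms]
      by (simp add: one_cls Q.one_cls)
  next
    case (Cons x u)
    have W: "[x] \<in> words" "u \<in> words" using Cons.hyps by auto
    have "F (cls [x]) = Q.cls [proj x]"
      using F(2,3) Cons.hyps(1) by (cases x) (auto simp: proj_def)
    then show ?case
      using Cons.IH cls_mult[OF W] hom_mult[OF F(1) cls_carrier[OF W(1)] cls_carrier[OF W(2)]]
        Q.cls_mult[OF proj_words[OF W(1)] proj_words[OF W(2)]] by simp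
  qed
  then show ?thesis using F(1) by blast
qed

definition \<rho> :: "('a + 'b) list set \<Rightarrow> ('a set + 'b set) list set" where
  "\<rho> = (SOME \<rho>. \<rho> \<in> hom G Q.G \<and> (\<forall>u\<in>words. \<rho> (cls u) = Q.cls (map proj u)))"

lemma \<rho>_spec: "\<rho> \<in> hom G Q.G \<and> (\<forall>u\<in>words. \<rho> (cls u) = Q.cls (map proj u))"
  unfolding \<rho>_def by (rule someI_ex[OF ex_quotient_map[unfolded Bex_def]])

lemmas \<rho>_hom = \<rho>_spec[THEN conjunct1]
lemmas \<rho>_cls = \<rho>_spec[THEN conjunct2, THEN bspec]

sublocale \<rho>: group_hom G Q.G \<rho>
  by (intro group_hom.intro group_hom_axioms.intro G.group_axioms Q.G.group_axioms \<rho>_hom)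

text \<open>Both quotients are finite, so the image of the cyclic subgroup is finitely separable in their
amalgam, and the separating homomorphism can be pulled back along \<^term>\<open>\<rho>\<close>.\<close>
lemma separated_in_finite_quotient:
  assumes fin: "finite (rcosets\<^bsub>A\<^esub> R)" "finite (rcosets\<^bsub>B\<^esub> S)"
    and c: "c \<in> carrier G" and g: "g \<in> carrier G" "\<rho> g \<notin> generate Q.G {\<rho> c}"
  shows "\<exists>(L :: nat monoid) \<psi>. group L \<and> finite (carrier L) \<and> \<psi> \<in> epi G L \<and>
    \<psi> g \<notin> \<psi> ` generate G {c}"
proof -
  have "finite (carrier (A Mod R))" "finite (carrier (B Mod S))"
    using fin by (simp_all add: FactGroup_def)
  then obtain X :: "(('a set + 'b set) list set set \<times> 'b set) set" and \<psi> where
    X: "finite X" "\<psi> \<in> hom Q.G (BijGroup X)" "\<psi> (\<rho> g) \<notin> \<psi> ` generate Q.G {\<rho> c}"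
    using Q.finite_amalgam_cyclic_separable[of "\<rho> c" "\<rho> g"] c g by auto
  have "generate Q.G {\<rho> c} = \<rho> ` generate G {c}"
    using \<rho>.generate_img[of "{c}"] c by simp
  then have "(\<psi> \<circ> \<rho>) g \<notin> (\<psi> \<circ> \<rho>) ` generate G {c}"
    using X(3) by (simp add: image_comp)
  moreover have "generate G {c} \<subseteq> carrier G" using c by (intro G.generate_incl) auto
  ultimately show ?thesis
    by (intro separating_epimorphism_onto_nat_group[OF G.group_axioms group_BijGroup
        finite_BijGroup[OF X(1)] hom_compose[OF \<rho>_hom X(2)] _ g(1)])
qed

text \<open>A letter outside the product of \<^term>\<open>H\<close> and \<^term>\<open>R\<close> projects to a coset that contains no
element of \<^term>\<open>H\<close>, hence to a letter outside the amalgamated subgroup of the quotient.\<close>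
lemma proj_reduced:
  assumes u: "u \<in> words" "reduced_word (H <#>\<^bsub>A\<^esub> R) (K <#>\<^bsub>B\<^esub> S) u"
  shows "Q.syllables (\<rho> (cls u)) = map isl u"
    and "reduced_word HR KS (map proj u)"
    and "reduced_word H K u"
proof -
  have isl: "isl (proj x) = isl x" for x by (cases x) (auto simp: proj_def)
  have outA: "a \<in> H <#>\<^bsub>A\<^esub> R" if a: "a \<in> carrier A" "R #>\<^bsub>A\<^esub> a \<in> HR" for a
  proof -
    obtain h where h: "h \<in> H" "R #>\<^bsub>A\<^esub> a = R #>\<^bsub>A\<^esub> h" using a(2) by (auto simp: HR_def)
    then have "a \<in> R #>\<^bsub>A\<^esub> h" using A.rcos_self[OF a(1) R_sub] by simp
    then have "a \<in> R <#>\<^bsub>A\<^esub> H" using h(1) by (auto simp: r_coset_def set_mult_def)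
    then show ?thesis using A.commut_normal[OF H.subgroup_axioms R] by simp
  qed
  have outB: "b \<in> K <#>\<^bsub>B\<^esub> S" if b: "b \<in> carrier B" "S #>\<^bsub>B\<^esub> b \<in> KS" for b
  proof -
    obtain k where k: "k \<in> K" "S #>\<^bsub>B\<^esub> b = S #>\<^bsub>B\<^esub> k" using b(2) by (auto simp: KS_def)
    then have "b \<in> S #>\<^bsub>B\<^esub> k" using B.rcos_self[OF b(1) S_sub] by simp
    then have "b \<in> S <#>\<^bsub>B\<^esub> K" using k(1) by (auto simp: r_coset_def set_mult_def)
    then show ?thesis using B.commut_normal[OF K.subgroup_axioms S] by simp
  qed
  have out: "proj x \<notin> HR <+> KS" if x: "x \<in> set u" for x
  proof -
    have "x \<in> carrier A <+> carrier B" "x \<notin> (H <#>\<^bsub>A\<^esub> R) <+> (K <#>\<^bsub>B\<^esub> S)"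
      using x u by (auto simp: reduced_word_def)
    then show ?thesis using outA outB unfolding proj_def by (elim PlusE) auto
  qed
  have map_isl: "map isl (map proj u) = map isl u" by (simp add: isl comp_def)
  show red: "reduced_word HR KS (map proj u)"
    using u(2) out unfolding reduced_word_iff map_isl by simp
  show "Q.syllables (\<rho> (cls u)) = map isl u"
    using Q.syllables_reduced[OF proj_words[OF u(1)] red] unfolding \<rho>_cls[OF u(1)] map_isl .
  have "H <#>\<^bsub>A\<^esub> {\<one>\<^bsub>A\<^esub>} \<subseteq> H <#>\<^bsub>A\<^esub> R" "K <#>\<^bsub>B\<^esub> {\<one>\<^bsub>B\<^esub>} \<subseteq> K <#>\<^bsub>B\<^esub> S"
    using subgroup.one_closed[OF R_sub] subgroup.one_closed[OF S_sub]
    by (intro mono_set_mult; simp)+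
  moreover have "H <#>\<^bsub>A\<^esub> {\<one>\<^bsub>A\<^esub>} = H" "K <#>\<^bsub>B\<^esub> {\<one>\<^bsub>B\<^esub>} = K"
    by (auto simp: set_mult_def)
  ultimately have "H \<subseteq> H <#>\<^bsub>A\<^esub> R" "K \<subseteq> K <#>\<^bsub>B\<^esub> S" by auto
  then show "reduced_word H K u"
    using u(2) unfolding reduced_word_iff by (auto elim!: PlusE)
qed

lemma \<rho>_inl: "a \<in> carrier A \<Longrightarrow> \<rho> (cls [Inl a]) = Q.cls [Inl (R #>\<^bsub>A\<^esub> a)]"
  using \<rho>_cls[of "[Inl a]"] by (simp add: proj_def)

lemma \<rho>_inr: "b \<in> carrier B \<Longrightarrow> \<rho> (cls [Inr b]) = Q.cls [Inr (S #>\<^bsub>B\<^esub> b)]"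
  using \<rho>_cls[of "[Inr b]"] by (simp add: proj_def)

lemma rigid_syllables:
  assumes "rigid g R S"
  shows "Q.syllables (\<rho> g) = syllables g"
  using assms unfolding rigid_def
proof (elim disjE bexE conjE)
  fix u assume "u \<in> words" "reduced_word (H <#>\<^bsub>A\<^esub> R) (K <#>\<^bsub>B\<^esub> S) u" "g = cls u"
  then show ?thesis by (simp only: proj_reduced(1,3) syllables_reduced)
next
  fix h assume h: "h \<in> H" "g = cls [Inl h]"
  have "R #>\<^bsub>A\<^esub> h \<in> HR" using h(1) unfolding HR_def by (rule imageI)
  then show ?thesis using h by (simp only: \<rho>_inl[OF H.mem_carrier[OF h(1)]] Q.syllables_H syllables_H)
qed

lemma rigid_trivial:
  assumes "rigid g R S" "\<rho> g = \<one>\<^bsub>Q.G\<^esub>"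
  shows "g = \<one>\<^bsub>G\<^esub>"
  using assms(1) unfolding rigid_def
proof (elim disjE bexE conjE)
  fix u assume u: "u \<in> words" "reduced_word (H <#>\<^bsub>A\<^esub> R) (K <#>\<^bsub>B\<^esub> S) u" "g = cls u"
  have "map isl u = []"
    using proj_reduced(1)[OF u(1,2)] unfolding u(3)[symmetric] assms(2) Q.syllables_one by (rule HOL.sym)
  then show ?thesis unfolding u(3) by (simp add: one_cls)
next
  fix h assume h: "h \<in> H" "g = cls [Inl h]" "h \<in> R \<longrightarrow> h = \<one>\<^bsub>A\<^esub>"
  have hA: "h \<in> carrier A" by (rule H.mem_carrier[OF h(1)])
  have "Q.cls [Inl (R #>\<^bsub>A\<^esub> h)] = \<one>\<^bsub>Q.G\<^esub>"
    using assms(2) unfolding h(2) \<rho>_inl[OF hA] .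
  from Q.inl_eq_one[OF projA.hom_closed[OF hA] this] have "R #>\<^bsub>A\<^esub> h = R"
    unfolding one_FactGroup .
  then have "h \<in> R" by (rule A.coset_join1[OF _ hA R_sub])
  then have "h = \<one>\<^bsub>A\<^esub>" using h(3) by blast
  then show ?thesis using cls_eqI[OF amalg_cong.one_A] unfolding h(2) one_cls by (simp only:)
qed

end

section \<open>Separation of cyclic subgroups\<close>

lemma (in group) generate_singleton_pow:
  assumes "c \<in> carrier G"
  shows "c [^] (n :: nat) \<in> generate G {c}"
proof -
  have "c [^] (int n) \<in> generate G {c}" unfolding generate_pow[OF assms] by blast
  then show ?thesis by (simp add: int_pow_int)
qed

context amalgam
begin

lemma Omega_quotient:
  assumes "(R, S) \<in> Omega A B H K \<phi>"
  shows "amalgam_quotient A B H K \<phi> R S" "finite (rcosets\<^bsub>A\<^esub> R)" "finite (rcosets\<^bsub>B\<^esub> S)"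
  using assms amalgam_axioms
  by (auto simp: Omega_def amalgam_quotient_def amalgam_quotient_axioms_def)

text \<open>If \<open>\<rho> x\<close> is the \<open>m\<close>-th power of \<open>\<rho> c\<close> with \<open>m \<ge> 0\<close>, counting syllables gives
\<open>m = \<bar>x\<bar> / \<bar>c\<bar>\<close>.  So for each \<open>x\<close> a single power of \<open>c\<close> can be in the way, and
keeping \<open>x\<close> divided by it nontrivial removes it.  Using this for \<^term>\<open>g\<close> and its inverse
covers positive and negative powers.\<close>

lemma separate_cyclically_reduced:
  assumes filt: "filtration A H (Omega_A A B H K \<phi>)" "filtration B K (Omega_B A B H K \<phi>)"
    and u: "u \<in> words" "cyclically_reduced u" "u \<noteq> []"
    and g: "g \<in> carrier G" "g \<notin> generate G {cls u}"
  shows "\<exists>(L :: nat monoid) \<psi>. group L \<and> finite (carrier L) \<and> \<psi> \<in> epi G L \<and>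
    \<psi> g \<notin> \<psi> ` generate G {cls u}"
proof -
  define c where "c = cls u"
  have c: "c \<in> carrier G" unfolding c_def by (rule cls_carrier[OF u(1)])
  \<comment> \<open>If the division leaves a remainder then no power interferes, and \<open>power x\<close> is harmless.\<close>
  define power where "power x = c [^]\<^bsub>G\<^esub> (length (syllables x) div length u)" for x
  have power: "power x \<in> carrier G" "power x \<in> generate G {c}" for x
    unfolding power_def using c G.generate_singleton_pow by auto
  define E where "E = {g, inv\<^bsub>G\<^esub> g, g \<otimes>\<^bsub>G\<^esub> inv\<^bsub>G\<^esub> power g, inv\<^bsub>G\<^esub> g \<otimes>\<^bsub>G\<^esub> inv\<^bsub>G\<^esub> power (inv\<^bsub>G\<^esub> g)}"
  have E: "E \<subseteq> carrier G" "finite E" unfolding E_def using g(1) power(1) by simp_all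
  define Ps where "Ps = insert (\<lambda>R S. reduced_word (H <#>\<^bsub>A\<^esub> R) (K <#>\<^bsub>B\<^esub> S) u) (rigid ` E)"
  have "\<exists>R S. (R, S) \<in> Omega A B H K \<phi> \<and> (\<forall>P\<in>Ps. P R S)"
  proof (rule Omega_all)
    show "finite Ps" using E(2) by (simp add: Ps_def)
    fix P assume "P \<in> Ps"
    then consider "P = (\<lambda>R S. reduced_word (H <#>\<^bsub>A\<^esub> R) (K <#>\<^bsub>B\<^esub> S) u)"
      | x where "x \<in> carrier G" "P = rigid x"
      unfolding Ps_def using E(1) by blast
    then show "persistent P \<and> (\<exists>(R, S)\<in>Omega A B H K \<phi>. P R S)"
    proof cases
      case 1
      then show ?thesis
        using persistent_reduced stays_reduced[OF filt u(1)] u(2) by (simp add: cyclically_reduced_def)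
    next
      case 2
      then show ?thesis using persistent_rigid ex_rigid[OF filt 2(1)] by simp
    qed
  qed
  then obtain R S where RS: "(R, S) \<in> Omega A B H K \<phi>" and Ps: "\<forall>P\<in>Ps. P R S" by blast
  have red: "reduced_word (H <#>\<^bsub>A\<^esub> R) (K <#>\<^bsub>B\<^esub> S) u"
    using Ps unfolding Ps_def by simp
  have rig: "rigid x R S" "rigid (x \<otimes>\<^bsub>G\<^esub> inv\<^bsub>G\<^esub> power x) R S" if "x \<in> {g, inv\<^bsub>G\<^esub> g}" for x
    using Ps that unfolding Ps_def E_def by auto
  interpret q: amalgam_quotient A B H K \<phi> R S by (rule Omega_quotient(1)[OF RS])
  let ?v = "map q.proj u"
  have v: "?v \<in> q.Q.words" "?v \<noteq> []" by (rule q.proj_words[OF u(1)]) (simp add: u(3))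
  have isl: "isl (q.proj x) = isl x" for x by (cases x) (simp_all add: q.proj_def)
  have "q.Q.cyclically_reduced ?v"
    using q.proj_reduced(2)[OF u(1) red] u(2,3)
    by (simp add: q.Q.cyclically_reduced_def cyclically_reduced_def hd_map last_map isl)
  then have len: "length (q.Q.syllables (q.\<rho> c [^]\<^bsub>q.Q.G\<^esub> m)) = m * length u" for m :: nat
    using q.Q.syllables_power[OF v(1) _ v(2)] unfolding c_def q.\<rho>_cls[OF u(1)] by simp
  have pos: "x \<in> generate G {c}" if x: "x \<in> {g, inv\<^bsub>G\<^esub> g}" and eq: "q.\<rho> x = q.\<rho> c [^]\<^bsub>q.Q.G\<^esub> (m :: nat)" for x m
  proof -
    have xG: "x \<in> carrier G" using x g(1) by auto
    have "length (syllables x) = m * length u"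
      using q.rigid_syllables[OF rig(1)[OF x]] len[of m] eq by simp
    then have "power x = c [^]\<^bsub>G\<^esub> m" using u(3) by (simp add: power_def)
    then have "q.\<rho> (power x) = q.\<rho> x" using eq q.\<rho>.hom_nat_pow[OF c] by simp
    then have "q.\<rho> (x \<otimes>\<^bsub>G\<^esub> inv\<^bsub>G\<^esub> power x) = \<one>\<^bsub>q.Q.G\<^esub>"
      using xG power(1)[of x] q.\<rho>.hom_closed[OF xG]
      by (simp add: q.\<rho>.hom_mult q.\<rho>.hom_inv q.Q.G.r_inv)
    then have "x \<otimes>\<^bsub>G\<^esub> inv\<^bsub>G\<^esub> power x = \<one>\<^bsub>G\<^esub>" by (rule q.rigid_trivial[OF rig(2)[OF x]])
    then have "x = power x"
      using xG power(1)[of x] G.inv_equality[of x "inv\<^bsub>G\<^esub> power x"] by simp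
    then show ?thesis using power(2)[of x] by simp
  qed
  have "q.\<rho> g \<notin> generate q.Q.G {q.\<rho> c}"
  proof
    assume "q.\<rho> g \<in> generate q.Q.G {q.\<rho> c}"
    then obtain j :: int where j: "q.\<rho> g = q.\<rho> c [^]\<^bsub>q.Q.G\<^esub> j"
      using q.Q.G.generate_pow[OF q.\<rho>.hom_closed[OF c]] by blast
    show False
    proof (cases "0 \<le> j")
      case True
      then have "q.\<rho> g = q.\<rho> c [^]\<^bsub>q.Q.G\<^esub> nat j" using j by (metis int_nat_eq int_pow_int)
      then show False using pos[of g "nat j"] g(2) c_def by simp
    next
      case False
      have "q.\<rho> (inv\<^bsub>G\<^esub> g) = inv\<^bsub>q.Q.G\<^esub> (q.\<rho> c [^]\<^bsub>q.Q.G\<^esub> j)" using g(1) j by simp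
      also have "\<dots> = q.\<rho> c [^]\<^bsub>q.Q.G\<^esub> (- j)"
        using q.Q.G.int_pow_neg[OF q.\<rho>.hom_closed[OF c]] by simp
      also have "\<dots> = q.\<rho> c [^]\<^bsub>q.Q.G\<^esub> nat (- j)"
        using False int_pow_int[of q.Q.G "q.\<rho> c" "nat (- j)"] by simp
      finally have "inv\<^bsub>G\<^esub> g \<in> generate G {c}" using pos[of "inv\<^bsub>G\<^esub> g"] by simp
      moreover have "subgroup (generate G {c}) G" using c by (intro G.generate_is_subgroup) auto
      ultimately show False using subgroup.m_inv_closed[of "generate G {c}" G "inv\<^bsub>G\<^esub> g"] g c_def by simp
    qed
  qed
  then show ?thesis
    using q.separated_in_finite_quotient[OF Omega_quotient(2,3)[OF RS] c g(1)] unfolding c_def by blast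
qed

text \<open>Two elements can collide in the quotient only if they have the same syllables there.  Hence only
elements \<^term>\<open>g\<close> of the same factor are critical, and for them the question is whether
\<^term>\<open>g\<close> lies in the product of the cyclic subgroup with \<open>R\<close>.\<close>

lemma separate_in_A:
  assumes filt: "filtration A H (Omega_A A B H K \<phi>)" "filtration B K (Omega_B A B H K \<phi>)"
    and a: "a \<in> carrier A" and sep: "separable_by A (generate A {a}) (Omega_A A B H K \<phi>)"
    and g: "g \<in> carrier G" "g \<notin> generate G {cls [Inl a]}"
  shows "\<exists>(L :: nat monoid) \<psi>. group L \<and> finite (carrier L) \<and> \<psi> \<in> epi G L \<and>
    \<psi> g \<notin> \<psi> ` generate G {cls [Inl a]}"
proof -
  have c: "cls [Inl a] \<in> carrier G" by (rule hom_in_carrier[OF inl_hom a])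
  have "\<exists>R S. (R, S) \<in> Omega A B H K \<phi> \<and> (if g \<in> (\<lambda>a. cls [Inl a]) ` carrier A
    then \<forall>x\<in>carrier A. g = cls [Inl x] \<longrightarrow> x \<notin> generate A {a} <#>\<^bsub>A\<^esub> R else rigid g R S)"
  proof (cases "g \<in> (\<lambda>a. cls [Inl a]) ` carrier A")
    case True
    then obtain x where x: "x \<in> carrier A" "g = cls [Inl x]" by blast
    have "x \<notin> generate A {a}" using g(2) x(2) generate_inl[OF a] by auto
    then obtain R S where "(R, S) \<in> Omega A B H K \<phi>" "x \<notin> generate A {a} <#>\<^bsub>A\<^esub> R"
      using sep x(1) unfolding separable_by_def Omega_A_def by fastforce
    moreover have "y = x" if "y \<in> carrier A" "g = cls [Inl y]" for y
      using inj_onD[OF inl_inj, of y x] that x by simp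
    ultimately show ?thesis using True by auto
  next
    case False
    then show ?thesis using ex_rigid[OF filt g(1)] by auto
  qed
  then obtain R S where RS: "(R, S) \<in> Omega A B H K \<phi>" and kept: "if g \<in> (\<lambda>a. cls [Inl a]) ` carrier A
    then \<forall>x\<in>carrier A. g = cls [Inl x] \<longrightarrow> x \<notin> generate A {a} <#>\<^bsub>A\<^esub> R else rigid g R S"
    by blast
  interpret q: amalgam_quotient A B H K \<phi> R S by (rule Omega_quotient(1)[OF RS])
  have "q.\<rho> g \<notin> generate q.Q.G {q.\<rho> (cls [Inl a])}"
  proof
    assume "q.\<rho> g \<in> generate q.Q.G {q.\<rho> (cls [Inl a])}"
    then obtain U where U: "U \<in> generate (A Mod R) {R #>\<^bsub>A\<^esub> a}" "q.\<rho> g = q.Q.cls [Inl U]"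
      unfolding q.\<rho>_inl[OF a] q.Q.generate_inl[OF q.projA.hom_closed[OF a]] by blast
    have UR: "U \<in> carrier (A Mod R)"
      using U(1) q.projA.H.generate_incl[of "{R #>\<^bsub>A\<^esub> a}"] q.projA.hom_closed[OF a] by blast
    show False
    proof (cases "g \<in> (\<lambda>a. cls [Inl a]) ` carrier A")
      case True
      then obtain x where x: "x \<in> carrier A" "g = cls [Inl x]" by blast
      have xn: "x \<notin> generate A {a} <#>\<^bsub>A\<^esub> R" using kept True x by simp
      have "R #>\<^bsub>A\<^esub> x = U"
        using inj_onD[OF q.Q.inl_inj, of "R #>\<^bsub>A\<^esub> x" U] U(2) UR q.projA.hom_closed[OF x(1)]
        unfolding x(2) q.\<rho>_inl[OF x(1)] by simp
      moreover have "generate (A Mod R) {R #>\<^bsub>A\<^esub> a} = (\<lambda>x. R #>\<^bsub>A\<^esub> x) ` generate A {a}"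
        using q.projA.generate_img[of "{a}"] a by simp
      ultimately obtain y where y: "y \<in> generate A {a}" "R #>\<^bsub>A\<^esub> x = R #>\<^bsub>A\<^esub> y" using U(1) by blast
      then have "x \<in> R #>\<^bsub>A\<^esub> y" using A.rcos_self[OF x(1) q.R_sub] by simp
      then have "x \<in> R <#>\<^bsub>A\<^esub> generate A {a}" using y(1) by (auto simp: r_coset_def set_mult_def)
      moreover have "subgroup (generate A {a}) A" using a by (intro A.generate_is_subgroup) auto
      ultimately show False using xn A.commut_normal[OF _ q.R] by simp
    next
      case False
      then have "q.Q.syllables (q.\<rho> g) = syllables g" using kept q.rigid_syllables by simp
      moreover have "q.Q.syllables (q.\<rho> g) \<in> {[], [True]}"
        using q.Q.syllables_A[OF UR] unfolding U(2) by (simp split: if_splits)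
      ultimately show False using False in_range_inl_iff[OF g(1)] by simp
    qed
  qed
  then show ?thesis
    by (rule q.separated_in_finite_quotient[OF Omega_quotient(2,3)[OF RS] c g(1)])
qed

lemma separate_in_B:
  assumes filt: "filtration A H (Omega_A A B H K \<phi>)" "filtration B K (Omega_B A B H K \<phi>)"
    and b: "b \<in> carrier B" and sep: "separable_by B (generate B {b}) (Omega_B A B H K \<phi>)"
    and g: "g \<in> carrier G" "g \<notin> generate G {cls [Inr b]}"
  shows "\<exists>(L :: nat monoid) \<psi>. group L \<and> finite (carrier L) \<and> \<psi> \<in> epi G L \<and>
    \<psi> g \<notin> \<psi> ` generate G {cls [Inr b]}"
proof -
  have c: "cls [Inr b] \<in> carrier G" by (rule hom_in_carrier[OF inr_hom b])
  have "\<exists>R S. (R, S) \<in> Omega A B H K \<phi> \<and> (if g \<in> (\<lambda>b. cls [Inr b]) ` carrier B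
    then \<forall>x\<in>carrier B. g = cls [Inr x] \<longrightarrow> x \<notin> generate B {b} <#>\<^bsub>B\<^esub> S else rigid g R S)"
  proof (cases "g \<in> (\<lambda>b. cls [Inr b]) ` carrier B")
    case True
    then obtain x where x: "x \<in> carrier B" "g = cls [Inr x]" by blast
    have "x \<notin> generate B {b}" using g(2) x(2) generate_inr[OF b] by auto
    then obtain R S where "(R, S) \<in> Omega A B H K \<phi>" "x \<notin> generate B {b} <#>\<^bsub>B\<^esub> S"
      using sep x(1) unfolding separable_by_def Omega_B_def by fastforce
    moreover have "y = x" if "y \<in> carrier B" "g = cls [Inr y]" for y
      using inj_onD[OF inr_inj, of y x] that x by simp
    ultimately show ?thesis using True by auto
  next
    case False
    then show ?thesis using ex_rigid[OF filt g(1)] by auto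
  qed
  then obtain R S where RS: "(R, S) \<in> Omega A B H K \<phi>" and kept: "if g \<in> (\<lambda>b. cls [Inr b]) ` carrier B
    then \<forall>x\<in>carrier B. g = cls [Inr x] \<longrightarrow> x \<notin> generate B {b} <#>\<^bsub>B\<^esub> S else rigid g R S"
    by blast
  interpret q: amalgam_quotient A B H K \<phi> R S by (rule Omega_quotient(1)[OF RS])
  have "q.\<rho> g \<notin> generate q.Q.G {q.\<rho> (cls [Inr b])}"
  proof
    assume "q.\<rho> g \<in> generate q.Q.G {q.\<rho> (cls [Inr b])}"
    then obtain V where V: "V \<in> generate (B Mod S) {S #>\<^bsub>B\<^esub> b}" "q.\<rho> g = q.Q.cls [Inr V]"
      unfolding q.\<rho>_inr[OF b] q.Q.generate_inr[OF q.projB.hom_closed[OF b]] by blast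
    have VS: "V \<in> carrier (B Mod S)"
      using V(1) q.projB.H.generate_incl[of "{S #>\<^bsub>B\<^esub> b}"] q.projB.hom_closed[OF b] by blast
    show False
    proof (cases "g \<in> (\<lambda>b. cls [Inr b]) ` carrier B")
      case True
      then obtain x where x: "x \<in> carrier B" "g = cls [Inr x]" by blast
      have xn: "x \<notin> generate B {b} <#>\<^bsub>B\<^esub> S" using kept True x by simp
      have "S #>\<^bsub>B\<^esub> x = V"
        using inj_onD[OF q.Q.inr_inj, of "S #>\<^bsub>B\<^esub> x" V] V(2) VS q.projB.hom_closed[OF x(1)]
        unfolding x(2) q.\<rho>_inr[OF x(1)] by simp
      moreover have "generate (B Mod S) {S #>\<^bsub>B\<^esub> b} = (\<lambda>x. S #>\<^bsub>B\<^esub> x) ` generate B {b}"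
        using q.projB.generate_img[of "{b}"] b by simp
      ultimately obtain y where y: "y \<in> generate B {b}" "S #>\<^bsub>B\<^esub> x = S #>\<^bsub>B\<^esub> y" using V(1) by blast
      then have "x \<in> S #>\<^bsub>B\<^esub> y" using B.rcos_self[OF x(1) q.S_sub] by simp
      then have "x \<in> S <#>\<^bsub>B\<^esub> generate B {b}" using y(1) by (auto simp: r_coset_def set_mult_def)
      moreover have "subgroup (generate B {b}) B" using b by (intro B.generate_is_subgroup) auto
      ultimately show False using xn B.commut_normal[OF _ q.S] by simp
    next
      case False
      then have "q.Q.syllables (q.\<rho> g) = syllables g" using kept q.rigid_syllables by simp
      moreover have "q.Q.syllables (q.\<rho> g) \<in> {[], [False]}"
        using q.Q.syllables_B[OF VS] unfolding V(2) by (simp split: if_splits)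
      ultimately show False using False in_range_inr_iff[OF g(1)] by simp
    qed
  qed
  then show ?thesis
    by (rule q.separated_in_finite_quotient[OF Omega_quotient(2,3)[OF RS] c g(1)])
qed

end

text \<open>Finite separability and membership in \<open>\<Lambda>\<close> up to conjugacy are both invariant under conjugation,
so the generator may be taken in the form given by \<open>conjugate_normal_form\<close>.\<close>
theorem theorem1p2:
  fixes A :: "('a, 'm) monoid_scheme" and B :: "('b, 'n) monoid_scheme"
    and H :: "'a set" and K :: "'b set" and \<phi> :: "'a \<Rightarrow> 'b"
    and C :: "('a + 'b) list set set"
  assumes "group A" and "group B"
    and "subgroup H A" and "subgroup K B"
    and "\<phi> \<in> iso (A\<lparr>carrier := H\<rparr>) (B\<lparr>carrier := K\<rparr>)"
    and "filtration A H (Omega_A A B H K \<phi>)"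
    and "filtration B K (Omega_B A B H K \<phi>)"
    and "cyclic_subgroup C (amalg_product A B H \<phi>)"
    and "\<forall>L\<in>Lambda_A A B H K \<phi>.
      \<not> conjugate_in (amalg_product A B H \<phi>) C (amalg_inl A B H \<phi> ` L)"
    and "\<forall>L\<in>Lambda_B A B H K \<phi>.
      \<not> conjugate_in (amalg_product A B H \<phi>) C (amalg_inr A B H \<phi> ` L)"
  shows "finitely_separable C (amalg_product A B H \<phi>)"
proof -
  interpret amalgam A B H K \<phi>
    using assms(1-5) by (intro amalgam.intro amalgam_axioms.intro)
  note filt = assms(6,7)
  obtain c where c: "c \<in> carrier G" "C = generate G {c}"
    using assms(8) by (auto simp: cyclic_subgroup_def)
  obtain u g where u: "u \<in> words" and g: "g \<in> carrier G" "cls u = g \<otimes>\<^bsub>G\<^esub> c \<otimes>\<^bsub>G\<^esub> inv\<^bsub>G\<^esub> g"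
    and cases: "cyclically_reduced u \<and> u \<noteq> [] \<or> (\<exists>x\<in>carrier A <+> carrier B. u = [x])"
    using conjugate_normal_form[OF c(1)] by blast
  define D where "D = generate G {cls u}"
  have uG: "cls u \<in> carrier G" by (rule cls_carrier[OF u])
  have conj: "conjugate_in G C D"
  proof -
    interpret i: group_hom G G "\<lambda>x. inv\<^bsub>G\<^esub> g \<otimes>\<^bsub>G\<^esub> x \<otimes>\<^bsub>G\<^esub> g"
      by (intro group_hom.intro group_hom_axioms.intro G.group_axioms G.conjugation_hom[OF g(1)])
    have "inv\<^bsub>G\<^esub> g \<otimes>\<^bsub>G\<^esub> cls u \<otimes>\<^bsub>G\<^esub> g = c"
      unfolding g(2) using g(1) c(1) by (simp add: G.m_assoc G.inv_solve_left')
    then have "C = (\<lambda>x. inv\<^bsub>G\<^esub> g \<otimes>\<^bsub>G\<^esub> x \<otimes>\<^bsub>G\<^esub> g) ` D"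
      using i.generate_img[of "{cls u}"] uG c(2) by (simp add: D_def)
    then show ?thesis using g(1) unfolding conjugate_in_def by blast
  qed
  have "\<exists>(L :: nat monoid) \<psi>. group L \<and> finite (carrier L) \<and> \<psi> \<in> epi G L \<and> \<psi> y \<notin> \<psi> ` D"
    if y: "y \<in> carrier G" "y \<notin> D" for y
  proof -
    consider "cyclically_reduced u" "u \<noteq> []" | a where "a \<in> carrier A" "u = [Inl a]"
      | b where "b \<in> carrier B" "u = [Inr b]"
      using cases by blast
    then show ?thesis
    proof cases
      case 1
      then show ?thesis using separate_cyclically_reduced[OF filt u 1] y unfolding D_def by blast
    next
      case (2 a)
      have "D = amalg_inl A B H \<phi> ` generate A {a}"
        unfolding D_def 2(2) generate_inl[OF 2(1)] amalg_inl_def ..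
      then have "generate A {a} \<notin> Lambda_A A B H K \<phi>" using assms(9) conj by auto
      then have "separable_by A (generate A {a}) (Omega_A A B H K \<phi>)"
        using 2(1) by (auto simp: Lambda_A_def cyclic_subgroup_def)
      then show ?thesis using separate_in_A[OF filt 2(1)] y unfolding D_def 2(2) by blast
    next
      case (3 b)
      have "D = amalg_inr A B H \<phi> ` generate B {b}"
        unfolding D_def 3(2) generate_inr[OF 3(1)] amalg_inr_def ..
      then have "generate B {b} \<notin> Lambda_B A B H K \<phi>" using assms(10) conj by auto
      then have "separable_by B (generate B {b}) (Omega_B A B H K \<phi>)"
        using 3(1) by (auto simp: Lambda_B_def cyclic_subgroup_def)
      then show ?thesis using separate_in_B[OF filt 3(1)] y unfolding D_def 3(2) by blast
    qed
  qed
  moreover have "subgroup D G"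
    unfolding D_def using uG by (intro G.generate_is_subgroup) auto
  ultimately have "finitely_separable D G" unfolding finitely_separable_def by blast
  then show ?thesis using conj by (rule G.finitely_separable_conjugate)
qed

end
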